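(* For all integers $N\geq 2$, the group cohomology ring $H^\ast(GL_N(\mathbb{F}_2);\mathbb{F}_2)$ has a non-nilpotent element of degree $d$ for every natural number $d$ with at least $\lceil \log_2 N\rceil$ ones in its binary expansion.
   Context: $H^\ast(G;\mathbb{F}_2)$ denotes group cohomology with trivial $\mathbb{F}_2$-coefficients, a ring under the cup product. *)

theory Defs
  imports Complex_Main "HOL-Library.Z2" "HOL-Algebra.QuotRing" "HOL-Algebra.Subrings" "Jordan_Normal_Form.Matrix"
begin

text \<open>
  The type \<^typ>\<open>bit\<close> is the field with two elements. Group cohomology with trivial coefficients
  in it is computed from the (unnormalised) bar complex. A cochain of degree n is a function on
  n-tuples of group elements, and an element of the total complex, the direct sum of all degrees,
  is encoded as one function on lists of all lengths that vanishes on lists of large length.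
\<close>

definition cochains :: "('a, 'm) monoid_scheme \<Rightarrow> ('a list \<Rightarrow> bit) set" where
  "cochains G = {f. (\<forall>xs. f xs \<noteq> 0 \<longrightarrow> set xs \<subseteq> carrier G) \<and>
                    (\<exists>n. \<forall>xs. f xs \<noteq> 0 \<longrightarrow> length xs \<le> n)}"

definition homogeneous_cochains :: "('a, 'm) monoid_scheme \<Rightarrow> nat \<Rightarrow> ('a list \<Rightarrow> bit) set" where
  "homogeneous_cochains G n = {f. \<forall>xs. f xs \<noteq> 0 \<longrightarrow> set xs \<subseteq> carrier G \<and> length xs = n}"

definition cup :: "('a list \<Rightarrow> bit) \<Rightarrow> ('a list \<Rightarrow> bit) \<Rightarrow> 'a list \<Rightarrow> bit" where
  "cup f g xs = (\<Sum>i\<le>length xs. f (take i xs) * g (drop i xs))"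

definition cochain_ring :: "('a, 'm) monoid_scheme \<Rightarrow> ('a list \<Rightarrow> bit) ring" where
  "cochain_ring G = \<lparr>carrier = cochains G, monoid.mult = cup, one = (\<lambda>xs. if xs = [] then 1 else 0),
     zero = (\<lambda>_. 0), add = (\<lambda>f g xs. f xs + g xs)\<rparr>"

text \<open>
  The i-th face of the tuple [x1, ..., xn]: drop x1 if i = 0, drop xn if i = n, and otherwise
  replace the adjacent entries xi, x(i+1) by their product.
\<close>

definition face :: "('a, 'm) monoid_scheme \<Rightarrow> nat \<Rightarrow> 'a list \<Rightarrow> 'a list" where
  "face G i xs =
     (if i = 0 then tl xs
      else if i = length xs then butlast xs
      else take (i - 1) xs @ [xs ! (i - 1) \<otimes>\<^bsub>G\<^esub> xs ! i] @ drop (i + 1) xs)"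

text \<open>
  The usual signs in the coboundary are irrelevant in characteristic 2. The empty list is excluded
  since a coboundary has no component in degree 0.
\<close>

definition coboundary :: "('a, 'm) monoid_scheme \<Rightarrow> ('a list \<Rightarrow> bit) \<Rightarrow> 'a list \<Rightarrow> bit" where
  "coboundary G f xs =
     (if xs \<noteq> [] \<and> set xs \<subseteq> carrier G then \<Sum>i\<le>length xs. f (face G i xs) else 0)"

definition cocycles :: "('a, 'm) monoid_scheme \<Rightarrow> ('a list \<Rightarrow> bit) set" where
  "cocycles G = {f \<in> cochains G. coboundary G f = (\<lambda>_. 0)}"

definition coboundaries :: "('a, 'm) monoid_scheme \<Rightarrow> ('a list \<Rightarrow> bit) set" where
  "coboundaries G = coboundary G ` cochains G"

definition cocycle_ring :: "('a, 'm) monoid_scheme \<Rightarrow> ('a list \<Rightarrow> bit) ring" where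
  "cocycle_ring G = (cochain_ring G)\<lparr>carrier := cocycles G\<rparr>"

definition cohomology_ring :: "('a, 'm) monoid_scheme \<Rightarrow> ('a list \<Rightarrow> bit) set ring" where
  "cohomology_ring G = cocycle_ring G Quot coboundaries G"

definition cohomology :: "('a, 'm) monoid_scheme \<Rightarrow> nat \<Rightarrow> ('a list \<Rightarrow> bit) set set" where
  "cohomology G n =
     (\<lambda>f. coboundaries G +>\<^bsub>cocycle_ring G\<^esub> f) ` (cocycles G \<inter> homogeneous_cochains G n)"

definition nilpotent :: "('a, 'm) ring_scheme \<Rightarrow> 'a \<Rightarrow> bool" where
  "nilpotent R x \<longleftrightarrow> (\<exists>k::nat. x [^]\<^bsub>R\<^esub> k = \<zero>\<^bsub>R\<^esub>)"

definition GL :: "'a::field itself \<Rightarrow> nat \<Rightarrow> 'a mat monoid" where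
  "GL ty n = units_of (ring_mat ty n ())"

lemma group_GL: "group (GL ty n)"
proof -
  interpret semiring "ring_mat ty n ()"
    using semiring_mat[of n "()"] by (simp add: ring_mat_def)
  show ?thesis unfolding GL_def by (rule units_group)
qed

text \<open>The remainder shows that \<^const>\<open>cohomology_ring\<close> is indeed a ring.\<close>

declare add_bit_eq_xor [simp del] mult_bit_eq_and [simp del]

lemma cochainsI:
  assumes "\<And>xs. f xs \<noteq> 0 \<Longrightarrow> set xs \<subseteq> carrier G" "\<And>xs. f xs \<noteq> 0 \<Longrightarrow> length xs \<le> n"
  shows "f \<in> cochains G"
  using assms unfolding cochains_def by blast

lemma cup_closed:
  assumes "f \<in> cochains G" "g \<in> cochains G"
  shows "cup f g \<in> cochains G"
proof -
  obtain m n where m: "\<And>xs. f xs \<noteq> 0 \<Longrightarrow> length xs \<le> m" and n: "\<And>xs. g xs \<noteq> 0 \<Longrightarrow> length xs \<le> n"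
    using assms unfolding cochains_def by blast
  have *: "\<exists>i\<le>length xs. f (take i xs) \<noteq> 0 \<and> g (drop i xs) \<noteq> 0" if nz: "cup f g xs \<noteq> 0" for xs
  proof -
    obtain i where "i \<in> {..length xs}" "f (take i xs) * g (drop i xs) \<noteq> 0"
      by (rule sum.not_neutral_contains_not_neutral[OF nz[unfolded cup_def]])
    then show ?thesis
      by (intro exI[of _ i]) (auto simp del: bit_not_zero_iff)
  qed
  show ?thesis
  proof (rule cochainsI[where n = "m + n"])
    fix xs assume "cup f g xs \<noteq> 0"
    then obtain i where i: "i \<le> length xs" "f (take i xs) \<noteq> 0" "g (drop i xs) \<noteq> 0" using * by blast
    then have "set (take i xs) \<subseteq> carrier G" "set (drop i xs) \<subseteq> carrier G"
      using assms unfolding cochains_def by blast+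
    then have "set (take i xs @ drop i xs) \<subseteq> carrier G" unfolding set_append by blast
    then show "set xs \<subseteq> carrier G" by (simp only: append_take_drop_id)
    show "length xs \<le> m + n" using m[OF i(2)] n[OF i(3)] i(1) by simp
  qed
qed

lemma add_closed:
  assumes "f \<in> cochains G" "g \<in> cochains G"
  shows "(\<lambda>xs. f xs + g xs) \<in> cochains G"
proof -
  obtain m n where m: "\<And>xs. f xs \<noteq> 0 \<Longrightarrow> length xs \<le> m" and n: "\<And>xs. g xs \<noteq> 0 \<Longrightarrow> length xs \<le> n"
    using assms unfolding cochains_def by blast
  have fg: "f xs \<noteq> 0 \<or> g xs \<noteq> 0" if "f xs + g xs \<noteq> 0" for xs using that by auto
  show ?thesis
  proof (rule cochainsI[where n = "m + n"])
    fix xs assume "f xs + g xs \<noteq> 0"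
    note * = fg[OF this]
    then show "set xs \<subseteq> carrier G" using assms unfolding cochains_def by blast
    show "length xs \<le> m + n" using * m[of xs] n[of xs] by linarith
  qed
qed

lemma cup_assoc: "cup (cup f g) h = cup f (cup g h)"
proof
  fix xs :: "'a list"
  let ?n = "length xs"
  have "cup (cup f g) h xs = (\<Sum>i\<le>?n. \<Sum>j\<le>i. f (take j xs) * g (take (i - j) (drop j xs)) * h (drop i xs))"
    unfolding cup_def sum_distrib_right
    by (intro sum.cong refl) (auto simp: min_def drop_take)
  also have "\<dots> = (\<Sum>(i,j)\<in>(SIGMA i:{..?n}. {..i}). f (take j xs) * g (take (i - j) (drop j xs)) * h (drop i xs))"
    by (simp add: sum.Sigma)
  also have "\<dots> = (\<Sum>(j,k)\<in>(SIGMA j:{..?n}. {..?n - j}). f (take j xs) * g (take k (drop j xs)) * h (drop (k + j) xs))"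
    by (rule sum.reindex_bij_witness[where i = "\<lambda>(j,k). (k + j, j)" and j = "\<lambda>(i,j). (j, i - j)"]) auto
  also have "\<dots> = (\<Sum>j\<le>?n. \<Sum>k\<le>?n - j. f (take j xs) * g (take k (drop j xs)) * h (drop (k + j) xs))"
    by (simp add: sum.Sigma)
  also have "\<dots> = cup f (cup g h) xs"
    unfolding cup_def sum_distrib_left
    by (intro sum.cong refl) (auto simp: mult.assoc)
  finally show "cup (cup f g) h xs = cup f (cup g h) xs" .
qed

lemma one_cup: "cup (\<lambda>xs. if xs = [] then 1 else 0) f = f"
proof
  fix xs :: "'a list"
  have "cup (\<lambda>xs. if xs = [] then 1 else 0) f xs = (\<Sum>i\<le>length xs. if i = 0 then f xs else 0)"
    unfolding cup_def by (intro sum.cong) auto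
  then show "cup (\<lambda>xs. if xs = [] then 1 else 0) f xs = f xs" by simp
qed

lemma cup_one: "cup f (\<lambda>xs. if xs = [] then 1 else 0) = f"
proof
  fix xs :: "'a list"
  have "cup f (\<lambda>xs. if xs = [] then 1 else 0) xs = (\<Sum>i\<le>length xs. if i = length xs then f xs else 0)"
    unfolding cup_def by (intro sum.cong) auto
  then show "cup f (\<lambda>xs. if xs = [] then 1 else 0) xs = f xs" by simp
qed

lemma cup_add_left: "cup (\<lambda>xs. f xs + g xs) h = (\<lambda>xs. cup f h xs + cup g h xs)"
  by (simp add: cup_def fun_eq_iff distrib_right sum.distrib)

lemma cup_add_right: "cup h (\<lambda>xs. f xs + g xs) = (\<lambda>xs. cup h f xs + cup h g xs)"
  by (simp add: cup_def fun_eq_iff distrib_left sum.distrib)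

lemma ring_cochain_ring: "ring (cochain_ring G)"
proof (rule ringI)
  show "abelian_group (cochain_ring G)"
  proof (rule abelian_groupI)
    fix f assume f: "f \<in> carrier (cochain_ring G)"
    have "(\<lambda>xs. f xs + f xs) = (\<lambda>_. 0)" by (intro ext) (simp flip: mult_2)
    then have "f \<oplus>\<^bsub>cochain_ring G\<^esub> f = \<zero>\<^bsub>cochain_ring G\<^esub>"
      by (simp only: cochain_ring_def ring.simps)
    then show "\<exists>g\<in>carrier (cochain_ring G). g \<oplus>\<^bsub>cochain_ring G\<^esub> f = \<zero>\<^bsub>cochain_ring G\<^esub>"
      using f by (rule bexI)
  qed (auto simp: cochain_ring_def add_closed ac_simps intro: cochainsI)
  show "monoid (cochain_ring G)"
    by (rule monoidI)
       (auto simp: cochain_ring_def cup_closed cup_assoc one_cup cup_one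
             intro!: cochainsI[where n = 0] split: if_splits)
qed (simp_all add: cochain_ring_def cup_add_left cup_add_right)

lemma length_face: "i \<le> length xs \<Longrightarrow> length (face G i xs) = length xs - 1"
  by (auto simp: face_def)

lemma nth_face:
  assumes "i \<le> length xs" "p < length xs - 1"
  shows "face G i xs ! p =
    (if Suc p < i then xs ! p else if Suc p = i then xs ! p \<otimes>\<^bsub>G\<^esub> xs ! Suc p else xs ! Suc p)"
  using assms by (auto simp: face_def nth_tl nth_butlast nth_append nth_Cons
      intro!: arg_cong[where f = "(!) xs"] split: nat.splits)

lemma (in monoid) face_closed:
  assumes "i \<le> length xs" "set xs \<subseteq> carrier G"
  shows "set (face G i xs) \<subseteq> carrier G"
proof
  fix y assume "y \<in> set (face G i xs)"
  then obtain p where p: "p < length xs - 1" "y = face G i xs ! p"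
    using assms(1) by (auto simp: in_set_conv_nth length_face)
  have "xs ! q \<in> carrier G" if "q < length xs" for q using assms(2) that nth_mem by blast
  then show "y \<in> carrier G" using p assms(1) by (auto simp: nth_face)
qed

lemma (in monoid) face_face:
  assumes "i \<le> j" "Suc j \<le> length xs" "set xs \<subseteq> carrier G"
  shows "face G j (face G i xs) = face G i (face G (Suc j) xs)"
proof (rule nth_equalityI)
  show "length (face G j (face G i xs)) = length (face G i (face G (Suc j) xs))"
    using assms by (simp add: length_face)
  fix p assume "p < length (face G j (face G i xs))"
  then have p: "p < length xs - 2" using assms by (simp add: length_face)
  have c: "xs ! q \<in> carrier G" if "q < length xs" for q using assms(3) that nth_mem by blast
  show "face G j (face G i xs) ! p = face G i (face G (Suc j) xs) ! p"
    using assms p by (auto simp: length_face nth_face c m_assoc)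
qed

lemma bit_add_self: "(x::bit) + x = 0"
  by (simp flip: mult_2)

lemma (in monoid) coboundary_coboundary: "coboundary G (coboundary G f) = (\<lambda>_. 0)"
proof
  fix xs :: "'a list"
  let ?n = "length xs"
  show "coboundary G (coboundary G f) xs = 0"
  proof (cases "set xs \<subseteq> carrier G \<and> 2 \<le> ?n")
    case False
    have "coboundary G f (face G i xs) = 0" if "?n = 1" "i \<le> ?n" for i
      using length_face[of i xs G] that by (simp add: coboundary_def)
    then show ?thesis using False
      by (cases "?n = 1"; cases "?n = 0") (simp_all add: coboundary_def)
  next
    case True
    let ?F = "\<lambda>(i,j). f (face G j (face G i xs))"
    let ?A = "SIGMA i:{..?n}. {i..?n - 1}" and ?B = "SIGMA i:{..?n}. {j. j < i \<and> j \<le> ?n - 1}"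
    have "coboundary G f (face G i xs) = (\<Sum>j\<le>?n - 1. f (face G j (face G i xs)))" if "i \<le> ?n" for i
      using length_face[OF that, of G] face_closed[OF that] True by (auto simp: coboundary_def)
    then have "coboundary G (coboundary G f) xs = (\<Sum>i\<le>?n. \<Sum>j\<le>?n - 1. f (face G j (face G i xs)))"
      using True by (auto simp: coboundary_def intro!: sum.cong)
    also have "\<dots> = (\<Sum>x\<in>(SIGMA i:{..?n}. {..?n - 1}). ?F x)" by (simp add: sum.Sigma)
    also have "(SIGMA i:{..?n}. {..?n - 1}) = ?A \<union> ?B" by auto
    also have "sum ?F (?A \<union> ?B) = sum ?F ?A + sum ?F ?B"
      by (rule sum.union_disjoint) auto
    also have "sum ?F ?A = sum ?F ?B"
      by (rule sum.reindex_bij_witness[where i = "\<lambda>(i,j). (j, i - 1)" and j = "\<lambda>(i,j). (Suc j, i)"])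
         (use True in \<open>auto simp: face_face\<close>)
    finally show ?thesis by (simp add: bit_add_self)
  qed
qed

lemma face_take:
  assumes "i < m" "m \<le> length xs"
  shows "face G i (take m xs) = take (m - 1) (face G i xs)"
  using assms by (intro nth_equalityI) (auto simp: length_face nth_face)

lemma drop_face:
  assumes "i < m" "m \<le> length xs"
  shows "drop (m - 1) (face G i xs) = drop m xs"
  using assms by (intro nth_equalityI) (auto simp: length_face nth_face)

lemma take_face:
  assumes "0 < j" "m + j \<le> length xs"
  shows "take m (face G (m + j) xs) = take m xs"
  using assms by (intro nth_equalityI) (auto simp: length_face nth_face)

lemma face_drop:
  assumes "0 < j" "m + j \<le> length xs"
  shows "face G j (drop m xs) = drop m (face G (m + j) xs)"
  using assms by (intro nth_equalityI) (auto simp: length_face nth_face)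

lemma (in monoid) coboundary_cup:
  "coboundary G (cup f g) xs = cup (coboundary G f) g xs + cup f (coboundary G g) xs"
  if supp: "f \<in> cochains G" "g \<in> cochains G"
proof (cases "xs \<noteq> [] \<and> set xs \<subseteq> carrier G")
  case False
  have 0: "f ys = 0" "g ys = 0" "coboundary G f ys = 0" "coboundary G g ys = 0"
    if "\<not> set ys \<subseteq> carrier G" for ys
    using supp that unfolding cochains_def coboundary_def by (auto simp del: bit_not_zero_iff)
  show ?thesis
  proof (cases "xs = []")
    case False
    with \<open>\<not> (xs \<noteq> [] \<and> _)\<close> have ns: "\<not> set xs \<subseteq> carrier G" by simp
    have "\<not> set (take i xs) \<subseteq> carrier G \<or> \<not> set (drop i xs) \<subseteq> carrier G" for i
      using ns by (metis append_take_drop_id set_append Un_subset_iff)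
    then have "cup (coboundary G f) g xs = 0" "cup f (coboundary G g) xs = 0"
      unfolding cup_def using 0 by (metis (no_types, lifting) mult_eq_0_iff sum.neutral)+
    then show ?thesis using ns by (simp add: coboundary_def)
  qed (simp add: coboundary_def cup_def)
next
  case True
  let ?n = "length xs"
  have sub: "set (take i xs) \<subseteq> carrier G" "set (drop i xs) \<subseteq> carrier G" for i
    using True by (auto dest: in_set_takeD in_set_dropD)
  define a where "a m i = f (face G i (take m xs)) * g (drop m xs)" for m i
  define b where "b m j = f (take m xs) * g (face G j (drop m xs))" for m j
  define c where "c i k = f (take k (face G i xs)) * g (drop k (face G i xs))" for i k
  define e where "e m = f (take m xs) * g (drop (Suc m) xs)" for m
  have "cup (coboundary G f) g xs = (\<Sum>m\<le>?n. if m = 0 then 0 else \<Sum>i\<le>m. a m i)"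
    unfolding cup_def a_def using True
    by (intro sum.cong refl) (auto simp: coboundary_def sub sum_distrib_right min_def)
  also have "\<dots> = (\<Sum>m\<in>{1..?n}. \<Sum>i\<le>m. a m i)"
    by (intro sum.mono_neutral_cong_right) auto
  also have "\<dots> = (\<Sum>m\<in>{1..?n}. (\<Sum>i<m. a m i) + a m m)"
    by (intro sum.cong refl) (simp only: lessThan_Suc_atMost[symmetric] sum.lessThan_Suc)
  also have "\<dots> = (\<Sum>m\<in>{1..?n}. \<Sum>i<m. a m i) + (\<Sum>m\<in>{1..?n}. a m m)"
    by (simp add: sum.distrib)
  also have "(\<Sum>m\<in>{1..?n}. a m m) = (\<Sum>m<?n. e m)"
    by (rule sum.reindex_bij_witness[where i = Suc and j = "\<lambda>m. m - 1"])
       (auto simp: a_def e_def face_def butlast_take)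
  also have "(\<Sum>m\<in>{1..?n}. \<Sum>i<m. a m i) = (\<Sum>(m,i)\<in>(SIGMA m:{1..?n}. {..<m}). a m i)"
    by (simp add: sum.Sigma)
  also have "\<dots> = (\<Sum>(i,k)\<in>(SIGMA i:{..?n}. {k. i \<le> k \<and> k < ?n}). c i k)"
    by (rule sum.reindex_bij_witness[where i = "\<lambda>(i,k). (Suc k, i)" and j = "\<lambda>(m,i). (i, m - 1)"])
       (auto simp: a_def c_def face_take drop_face[unfolded One_nat_def])
  finally have 1: "cup (coboundary G f) g xs =
    (\<Sum>(i,k)\<in>(SIGMA i:{..?n}. {k. i \<le> k \<and> k < ?n}). c i k) + (\<Sum>m<?n. e m)" .
  have "cup f (coboundary G g) xs = (\<Sum>m\<le>?n. if m = ?n then 0 else \<Sum>j\<le>?n - m. b m j)"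
    unfolding cup_def b_def using True
    by (intro sum.cong refl) (auto simp: coboundary_def sub sum_distrib_left)
  also have "\<dots> = (\<Sum>m<?n. \<Sum>j\<le>?n - m. b m j)"
    by (intro sum.mono_neutral_cong_right) auto
  also have "\<dots> = (\<Sum>m<?n. b m 0 + (\<Sum>j\<in>{1..?n - m}. b m j))"
    by (simp add: atMost_atLeast0 sum.atLeast_Suc_atMost)
  also have "\<dots> = (\<Sum>m<?n. e m) + (\<Sum>m<?n. \<Sum>j\<in>{1..?n - m}. b m j)"
    by (simp add: sum.distrib b_def e_def face_def tl_drop drop_Suc)
  also have "(\<Sum>m<?n. \<Sum>j\<in>{1..?n - m}. b m j) = (\<Sum>(m,j)\<in>(SIGMA m:{..<?n}. {1..?n - m}). b m j)"
    by (simp add: sum.Sigma)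
  also have "\<dots> = (\<Sum>(i,k)\<in>(SIGMA i:{..?n}. {k. k < i \<and> k < ?n}). c i k)"
    by (rule sum.reindex_bij_witness[where i = "\<lambda>(i,k). (k, i - k)" and j = "\<lambda>(m,j). (m + j, m)"])
       (auto simp: b_def c_def face_drop take_face)
  finally have 2: "cup f (coboundary G g) xs =
    (\<Sum>m<?n. e m) + (\<Sum>(i,k)\<in>(SIGMA i:{..?n}. {k. k < i \<and> k < ?n}). c i k)" .
  have "coboundary G (cup f g) xs = (\<Sum>i\<le>?n. \<Sum>k\<le>?n - 1. c i k)"
    unfolding c_def using True by (auto simp: coboundary_def cup_def length_face intro!: sum.cong)
  also have "\<dots> = (\<Sum>(i,k)\<in>(SIGMA i:{..?n}. {..?n - 1}). c i k)"
    by (simp add: sum.Sigma)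
  also have "(SIGMA i:{..?n}. {..?n - 1}) =
      (SIGMA i:{..?n}. {k. i \<le> k \<and> k < ?n}) \<union> (SIGMA i:{..?n}. {k. k < i \<and> k < ?n})"
    using True by (cases xs) auto
  also have "(\<Sum>(i,k)\<in>\<dots>. c i k) =
      (\<Sum>(i,k)\<in>(SIGMA i:{..?n}. {k. i \<le> k \<and> k < ?n}). c i k) +
      (\<Sum>(i,k)\<in>(SIGMA i:{..?n}. {k. k < i \<and> k < ?n}). c i k)"
    by (rule sum.union_disjoint) auto
  finally have 3: "coboundary G (cup f g) xs =
      (\<Sum>(i,k)\<in>(SIGMA i:{..?n}. {k. i \<le> k \<and> k < ?n}). c i k) +
      (\<Sum>(i,k)\<in>(SIGMA i:{..?n}. {k. k < i \<and> k < ?n}). c i k)" .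
  have cancel: "x + y = (x + z) + (z + y)" for x y z :: bit
    by (cases x; cases y; cases z) simp_all
  show ?thesis unfolding 1 2 3 by (rule cancel)
qed

lemma (in monoid) coboundary_closed:
  assumes "f \<in> cochains G"
  shows "coboundary G f \<in> cochains G"
proof -
  obtain n where n: "\<And>xs. f xs \<noteq> 0 \<Longrightarrow> length xs \<le> n"
    using assms unfolding cochains_def by blast
  show ?thesis
  proof (rule cochainsI[where n = "Suc n"])
    fix xs assume nz: "coboundary G f xs \<noteq> 0"
    then show "set xs \<subseteq> carrier G" by (auto simp: coboundary_def split: if_splits)
    have "(\<Sum>i\<le>length xs. f (face G i xs)) \<noteq> 0"
      using nz by (auto simp: coboundary_def split: if_splits)
    then obtain i where "i \<in> {..length xs}" "f (face G i xs) \<noteq> 0"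
      by (rule sum.not_neutral_contains_not_neutral)
    then show "length xs \<le> Suc n" using n[of "face G i xs"] by (simp add: length_face)
  qed
qed

lemma coboundary_add:
  "coboundary G (\<lambda>xs. f xs + g xs) = (\<lambda>xs. coboundary G f xs + coboundary G g xs)"
  by (auto simp: coboundary_def sum.distrib)

lemma (in monoid) subring_cocycles: "subring (cocycles G) (cochain_ring G)"
proof -
  interpret C: ring "cochain_ring G" by (rule ring_cochain_ring)
  have minus: "\<ominus>\<^bsub>cochain_ring G\<^esub> f = f" if "f \<in> cochains G" for f
    using that by (intro C.minus_equality) (auto simp: cochain_ring_def bit_add_self)
  show ?thesis
  proof (rule C.subringI)
    show "cocycles G \<subseteq> carrier (cochain_ring G)" by (auto simp: cocycles_def cochain_ring_def)
    have "coboundary G (\<lambda>xs. if xs = [] then 1 else 0) xs = 0" for xs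
    proof (cases "length xs = 1")
      case True
      then obtain x where "xs = [x]" by (auto simp: length_Suc_conv)
      then show ?thesis by (simp add: coboundary_def face_def bit_add_self)
    next
      case False
      then show ?thesis
        using length_face[of _ xs G]
        by (auto simp: coboundary_def intro!: sum.neutral) (metis diff_is_0_eq le_Suc_eq
            le_zero_eq length_0_conv list.size(3) One_nat_def)
    qed
    then show "\<one>\<^bsub>cochain_ring G\<^esub> \<in> cocycles G"
      using C.one_closed by (auto simp: cocycles_def cochain_ring_def)
    fix f g assume f: "f \<in> cocycles G" and g: "g \<in> cocycles G"
    show "\<ominus>\<^bsub>cochain_ring G\<^esub> f \<in> cocycles G" using f minus by (simp add: cocycles_def)
    show "f \<otimes>\<^bsub>cochain_ring G\<^esub> g \<in> cocycles G"
      using f g by (auto simp: cocycles_def cochain_ring_def cup_closed coboundary_cup fun_eq_iff)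
        (simp add: cup_def)
    show "f \<oplus>\<^bsub>cochain_ring G\<^esub> g \<in> cocycles G"
      using f g by (auto simp: cocycles_def cochain_ring_def add_closed coboundary_add)
  qed
qed

lemma (in monoid) ideal_coboundaries: "ideal (coboundaries G) (cocycle_ring G)"
proof -
  interpret C: ring "cochain_ring G" by (rule ring_cochain_ring)
  interpret Z: ring "cocycle_ring G"
    unfolding cocycle_ring_def by (rule C.subring_is_ring[OF subring_cocycles])
  have sub: "coboundaries G \<subseteq> cocycles G"
    by (auto simp: coboundaries_def cocycles_def coboundary_closed coboundary_coboundary)
  have minus: "\<ominus>\<^bsub>cocycle_ring G\<^esub> f = f" if "f \<in> cocycles G" for f
    using that by (intro Z.minus_equality) (auto simp: cocycle_ring_def cochain_ring_def bit_add_self)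
  show ?thesis
  proof (rule idealI[OF Z.ring_axioms])
    show "subgroup (coboundaries G) (add_monoid (cocycle_ring G))"
    proof (rule group.subgroupI[OF Z.a_group])
      show "coboundaries G \<subseteq> carrier (add_monoid (cocycle_ring G))"
        using sub by (simp add: cocycle_ring_def)
      have "cochains G \<noteq> {}" using C.zero_closed by (auto simp: cochain_ring_def)
      then show "coboundaries G \<noteq> {}" by (simp add: coboundaries_def)
      fix f g assume f: "f \<in> coboundaries G" and g: "g \<in> coboundaries G"
      show "inv\<^bsub>add_monoid (cocycle_ring G)\<^esub> f \<in> coboundaries G"
        using minus[of f] f sub by (auto simp: a_inv_def)
      show "f \<otimes>\<^bsub>add_monoid (cocycle_ring G)\<^esub> g \<in> coboundaries G"
        using f g by (auto simp: coboundaries_def cocycle_ring_def cochain_ring_def add_closed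
            simp flip: coboundary_add)
    qed
    fix b z assume "b \<in> coboundaries G" and "z \<in> carrier (cocycle_ring G)"
    then obtain f where f: "f \<in> cochains G" "b = coboundary G f"
      and z: "z \<in> cochains G" "coboundary G z = (\<lambda>_. 0)"
      by (auto simp: coboundaries_def cocycle_ring_def cocycles_def)
    have "coboundary G (cup z f) = cup z b" "coboundary G (cup f z) = cup b z"
      using f z by (auto simp: fun_eq_iff coboundary_cup) (auto simp: cup_def)
    then show "z \<otimes>\<^bsub>cocycle_ring G\<^esub> b \<in> coboundaries G" "b \<otimes>\<^bsub>cocycle_ring G\<^esub> z \<in> coboundaries G"
      using cup_closed[OF f(1) z(1)] cup_closed[OF z(1) f(1)]
      by (auto simp: coboundaries_def cocycle_ring_def cochain_ring_def intro: rev_image_eqI)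
  qed
qed

lemma (in monoid) ring_cohomology_ring: "ring (cohomology_ring G)"
  unfolding cohomology_ring_def by (rule ideal.quotient_is_ring[OF ideal_coboundaries])

declare add_bit_eq_xor [simp] mult_bit_eq_and [simp]

end

theory Submission
  imports Defs "HOL-Computational_Algebra.Polynomial" "HOL-Computational_Algebra.Primes"
    "HOL-Library.Nat_Bijection" "HOL-Library.FuncSet"
begin

text \<open>
  The group GL_N acts on the two-element subsets of V = (F_2)^N, and "g interchanges the two points"
  is a degree 1 class on the action groupoid. The transfer to GL_N of its d-th power is the desired
  class. With n the ceiling of log_2 N, realise V as the span of N squarefree monomials in n
  variables, on which translations of the variables give n commuting involutions; let E be the
  group they generate. On H^*(E), a polynomial ring in y_1, ..., y_n, only E-fixed two-element
  subsets contribute. These are {v, v + 1} with v a linear form, so the restriction is the sum of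
  (the sum of y_i for i in S)^d over all S. It is nonzero because d has at least n binary ones.
\<close>

text \<open>Only E-fixed subsets contribute because any other orbit yields a transfer from a proper
  subgroup of E, and such transfers vanish mod 2 for elementary abelian groups. The proof does this
  with cochains: E and its cohomology are never formed, and a class is tested on words in the n
  involutions and the identity. The terms of a subset and of its partner in the orbit must then
  agree as values, not just up to a coboundary, and this depends on the cocycle chosen for the
  double cover. Hence the points chosen in the subsets are made compatible with the pairing. The
  generators of the polynomial ring are specialised to sparse powers of one variable X. The values
  lie in an integral domain, so a nonzero value excludes nilpotency. The ceiling enters as 2^(n-1) <
  N <= 2^n: the upper bound leaves the constants as the only E-invariant elements of V, and the
  lower bound puts all n variables, hence all linear forms, into V.\<close>

declare add_bit_eq_xor [simp del] mult_bit_eq_and [simp del]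

section \<open>Cancellation in characteristic 2\<close>

lemma bit_poly_add_self: "(p :: bit poly) + p = 0"
  by (rule poly_eqI) (simp only: coeff_add coeff_0 bit_add_self)

lemma bit_poly_const_add: "[:(a::bit) + b:] = [:a:] + [:b:]"
  by simp

lemma sum_symmetric_char2:
  fixes c :: "'i \<Rightarrow> 'i \<Rightarrow> 'b::comm_monoid_add"
  assumes char2: "\<And>y::'b. y + y = 0" and "finite J"
    and sym: "\<And>a b. a \<in> J \<Longrightarrow> b \<in> J \<Longrightarrow> c a b = c b a" and diag: "\<And>a. a \<in> J \<Longrightarrow> c a a = 0"
  shows "(\<Sum>a\<in>J. \<Sum>b\<in>J. c a b) = 0"
  using \<open>finite J\<close> sym diag
proof (induction J)
  case (insert x J)
  have "(\<Sum>b\<in>J. c x b) = (\<Sum>a\<in>J. c a x)"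
    by (intro sum.cong) (auto intro: insert.prems)
  moreover have "(\<Sum>a\<in>J. \<Sum>b\<in>J. c a b) = 0"
    using insert.prems by (intro insert.IH) auto
  ultimately show ?case
    using insert.hyps insert.prems(2)[of x] by (simp add: sum.distrib char2)
qed simp

lemma sum_free_involution_char2:
  fixes f :: "'x \<Rightarrow> 'b::comm_monoid_add"
  assumes char2: "\<And>y::'b. y + y = 0" and "finite X"
    and "\<And>x. x \<in> X \<Longrightarrow> \<sigma> x \<in> X" "\<And>x. x \<in> X \<Longrightarrow> \<sigma> (\<sigma> x) = x" "\<And>x. x \<in> X \<Longrightarrow> \<sigma> x \<noteq> x"
    and "\<And>x. x \<in> X \<Longrightarrow> f (\<sigma> x) = f x"
  shows "sum f X = 0"
  using assms(2-)
proof (induction X rule: finite_psubset_induct)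
  case (psubset X)
  note X = psubset.prems
  show ?case
  proof (cases "X = {}")
    case False
    then obtain x where x: "x \<in> X" by blast
    define Y where "Y = X - {x, \<sigma> x}"
    have inj: "\<sigma> y = \<sigma> z \<Longrightarrow> y = z" if "y \<in> X" "z \<in> X" for y z
      using X(2) that by metis
    have "\<sigma> y \<in> Y" if "y \<in> Y" for y
      using that x X(1) inj X(2) unfolding Y_def by (metis DiffE DiffI insert_iff singletonD)
    then have "sum f Y = 0"
      using x X(2,3,4) by (intro psubset.IH) (auto simp: Y_def)
    moreover have "X = insert x (insert (\<sigma> x) Y)"
      using x X(1)[OF x] by (auto simp: Y_def)
    moreover have "finite Y" "x \<notin> Y" "\<sigma> x \<notin> Y" "x \<noteq> \<sigma> x"
      using \<open>finite X\<close> X(3)[OF x] by (auto simp: Y_def)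
    ultimately have "sum f X = f x + (f (\<sigma> x) + sum f Y)"
      by simp
    then show ?thesis
      using \<open>sum f Y = 0\<close> X(4)[OF x] char2 by simp
  qed simp
qed

subsection \<open>Detecting classes on commuting involutions\<close>

text \<open>
  In characteristic 2 the element u, the sum of all r a * h a, of the group algebra over the
  polynomial ring has augmentation 0 and square 0. Hence every face of the chain [u|...|u]
  vanishes separately. The function eval m evaluates a cochain on this chain in degree m.
\<close>

locale commuting_involutions = group G for G (structure) +
  fixes J :: "'i set" and h :: "'i \<Rightarrow> 'a" and r :: "'i \<Rightarrow> bit poly"
  assumes finite_J: "finite J"
    and h_closed: "\<And>a. a \<in> J \<Longrightarrow> h a \<in> carrier G"
    and h_commute: "\<And>a b. a \<in> J \<Longrightarrow> b \<in> J \<Longrightarrow> h a \<otimes> h b = h b \<otimes> h a"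
    and h_square: "\<And>a. a \<in> J \<Longrightarrow> h a \<otimes> h a = \<one>"
    and sum_r: "sum r J = 0"
begin

primrec eval :: "nat \<Rightarrow> ('a list \<Rightarrow> bit) \<Rightarrow> bit poly" where
  "eval 0 f = [:f []:]"
| "eval (Suc m) f = (\<Sum>a\<in>J. r a * eval m (\<lambda>xs. f (h a # xs)))"

lemma eval_cong:
  assumes "\<And>as. length as = m \<Longrightarrow> set as \<subseteq> J \<Longrightarrow> f (map h as) = g (map h as)"
  shows "eval m f = eval m g"
  using assms
proof (induction m arbitrary: f g)
  case (Suc m)
  have "eval m (\<lambda>xs. f (h a # xs)) = eval m (\<lambda>xs. g (h a # xs))" if "a \<in> J" for a
    using Suc.prems[of "a # _"] that by (intro Suc.IH) simp
  then show ?case by simp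
qed simp

lemma eval_zero: "eval m (\<lambda>_. 0) = 0"
  by (induction m) simp_all

lemma eval_add: "eval m (\<lambda>xs. f xs + g xs) = eval m f + eval m g"
proof (induction m arbitrary: f g)
  case 0
  show ?case unfolding eval.simps bit_poly_const_add ..
next
  case (Suc m)
  show ?case unfolding eval.simps Suc.IH distrib_left sum.distrib ..
qed

lemma eval_sum: "eval m (\<lambda>xs. \<Sum>i\<in>I. f i xs) = (\<Sum>i\<in>I. eval m (f i))"
proof (induction I rule: infinite_finite_induct)
  case (insert i I)
  have "(\<lambda>xs. \<Sum>i\<in>insert i I. f i xs) = (\<lambda>xs. f i xs + (\<Sum>i\<in>I. f i xs))"
    using insert.hyps by (simp)
  then show ?case using insert eval_add[of m "f i"] by simp
qed (simp_all add: eval_zero)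

lemma eval_scale: "eval m (\<lambda>xs. c * f xs) = [:c:] * eval m f"
proof (induction m arbitrary: f)
  case 0
  show ?case by (simp)
next
  case (Suc m)
  show ?case unfolding eval.simps Suc.IH sum_distrib_left
    by (simp only: mult.left_commute)
qed

text \<open>The chain [u|...|u] splits into two chains of the same kind at every position, and
  homogeneity of \<open>g\<close> leaves only the split after \<open>m\<close> entries. This makes
  \<open>eval\<close> multiplicative.\<close>

lemma eval_cup:
  assumes "g \<in> homogeneous_cochains G k"
  shows "eval (m + k) (cup f g) = eval m f * eval k g"
proof -
  have "cup f g xs = f (take m xs) * g (drop m xs)" if "length xs = m + k" for xs
  proof -
    have summand: "f (take i xs) * g (drop i xs) = (if i = m then f (take m xs) * g (drop m xs) else 0)"
      if "i \<le> length xs" for i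
    proof (cases "i = m")
      case False
      then have "length (drop i xs) \<noteq> k" using that \<open>length xs = m + k\<close> by simp
      then have "g (drop i xs) = 0" using assms unfolding homogeneous_cochains_def by blast
      then show ?thesis using False by simp
    qed simp
    have "cup f g xs = (\<Sum>i\<le>length xs. if i = m then f (take m xs) * g (drop m xs) else 0)"
      unfolding cup_def by (rule sum.cong[OF refl], rule summand) simp
    then show ?thesis using that by simp
  qed
  then have "eval (m + k) (cup f g) = eval (m + k) (\<lambda>xs. f (take m xs) * g (drop m xs))"
    by (intro eval_cong) simp
  also have "\<dots> = eval m f * eval k g"
  proof (induction m arbitrary: f)
    case 0
    show ?case by (simp add: eval_scale)
  next
    case (Suc m)
    have "eval (m + k) (\<lambda>xs. f (x # take m xs) * g (drop m xs)) = eval m (\<lambda>xs. f (x # xs)) * eval k g" for x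
      by (rule Suc.IH)
    then show ?case by (simp add: sum_distrib_right mult.assoc)
  qed
  finally show ?thesis .
qed

lemma square_zero: "(\<Sum>a\<in>J. \<Sum>b\<in>J. r a * (r b * F (h a \<otimes> h b))) = 0"
proof -
  \<comment> \<open>Subtracting \<open>F \<one>\<close> makes the diagonal vanish, as
    \<open>sum_symmetric_char2\<close> requires; the correction is \<open>F \<one>\<close> times the
    square of \<open>sum r J\<close>.\<close>
  have "(\<Sum>a\<in>J. \<Sum>b\<in>J. r a * (r b * F (h a \<otimes> h b))) =
      (\<Sum>a\<in>J. \<Sum>b\<in>J. r a * (r b * (F (h a \<otimes> h b) - F \<one>))) + (\<Sum>a\<in>J. \<Sum>b\<in>J. r a * (r b * F \<one>))"
    by (simp add: algebra_simps flip: sum.distrib)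
  also have "(\<Sum>a\<in>J. \<Sum>b\<in>J. r a * (r b * (F (h a \<otimes> h b) - F \<one>))) = 0"
    by (rule sum_symmetric_char2)
       (simp_all add: bit_poly_add_self finite_J h_commute h_square mult.left_commute)
  also have "(\<Sum>a\<in>J. \<Sum>b\<in>J. r a * (r b * F \<one>)) = 0"
    by (simp add: sum_r flip: sum_distrib_left sum_distrib_right)
  finally show ?thesis by simp
qed

lemma eval_face:
  assumes "i \<le> Suc m"
  shows "eval (Suc m) (\<lambda>xs. f (face G i xs)) = 0"
proof (cases i)
  case 0
  then show ?thesis by (simp add: face_def sum_r flip: sum_distrib_right)
next
  case (Suc j)
  \<comment> \<open>Peeling off leading entries ends either with the product of the first two
    entries, killed by \<open>square_zero\<close>, or with the last face of a single entry, killed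
    by \<open>sum_r\<close>.\<close>
  have "eval (Suc m) (\<lambda>xs. f (face G (Suc j) xs)) = 0" if "j \<le> m" for j
    using that
  proof (induction m arbitrary: f j)
    case 0
    then show ?case by (simp add: face_def sum_r flip: sum_distrib_right del: mult_pCons_right)
  next
    case (Suc m)
    show ?case
    proof (cases j)
      case 0
      then show ?thesis
        unfolding eval.simps sum_distrib_left
        using square_zero[of "\<lambda>x. eval m (\<lambda>xs. f (x # xs))"] by (simp add: face_def)
    next
      case (Suc k)
      have "eval (Suc m) (\<lambda>xs. f (face G (Suc j) (x # xs))) = 0" for x
      proof -
        have "face G (Suc j) (x # xs) = x # face G j xs" if "length xs = Suc m" for xs
          using that \<open>j = Suc k\<close> \<open>j \<le> Suc m\<close> by (cases xs) (auto simp: face_def)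
        then have "eval (Suc m) (\<lambda>xs. f (face G (Suc j) (x # xs))) =
            eval (Suc m) (\<lambda>xs. f (x # face G j xs))"
          by (intro eval_cong) simp
        then show ?thesis
          using Suc.IH[of k "\<lambda>ys. f (x # ys)"] \<open>j = Suc k\<close> \<open>j \<le> Suc m\<close> by simp
      qed
      then have "(\<Sum>a\<in>J. r a * eval (Suc m) (\<lambda>xs. f (face G (Suc j) (h a # xs)))) = 0"
        by (simp only: mult_zero_right sum.neutral_const)
      then show ?thesis by (subst eval.simps(2))
    qed
  qed
  then show ?thesis using Suc assms by simp
qed

lemma eval_coboundary: "eval m (coboundary G f) = 0"
proof (cases m)
  case 0
  then show ?thesis by (simp add: coboundary_def)
next
  case (Suc k)
  have "eval m (coboundary G f) = eval m (\<lambda>xs. \<Sum>i\<le>m. f (face G i xs))"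
    using Suc h_closed by (intro eval_cong) (auto simp: coboundary_def)
  then show ?thesis
    unfolding Suc eval_sum using eval_face by simp
qed

text \<open>\<open>eval\<close> kills coboundaries, is multiplicative and has values in a domain, so
  no power of \<open>f\<close> can become a coboundary.\<close>

lemma not_nilpotent_cohomology:
  assumes "f \<in> cocycles G" "f \<in> homogeneous_cochains G d" "eval d f \<noteq> 0"
  shows "\<not> nilpotent (cohomology_ring G) (coboundaries G +>\<^bsub>cocycle_ring G\<^esub> f)"
proof
  let ?Z = "cocycle_ring G" and ?B = "coboundaries G"
  interpret B: ideal ?B ?Z by (rule ideal_coboundaries)
  interpret \<pi>: ring_hom_ring ?Z "?Z Quot ?B" "(+>\<^bsub>?Z\<^esub>) ?B"
    by (rule B.rcos_ring_hom_ring)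
  have f: "f \<in> carrier ?Z" using assms(1) by (simp add: cocycle_ring_def)
  have eval_pow: "eval (k * d) (f [^]\<^bsub>?Z\<^esub> k) = eval d f ^ k" for k :: nat
  proof (induction k)
    case 0
    show ?case by (simp add: cocycle_ring_def cochain_ring_def one_pCons)
  next
    case (Suc k)
    have "f [^]\<^bsub>?Z\<^esub> Suc k = cup (f [^]\<^bsub>?Z\<^esub> k) f"
      by (simp add: cocycle_ring_def cochain_ring_def)
    moreover have "Suc k * d = k * d + d" by simp
    ultimately show ?case using eval_cup[OF assms(2)] Suc.IH by (simp only: power_Suc2)
  qed
  assume "nilpotent (cohomology_ring G) (?B +>\<^bsub>?Z\<^esub> f)"
  then have "\<exists>k::nat. (?B +>\<^bsub>?Z\<^esub> f) [^]\<^bsub>?Z Quot ?B\<^esub> k = \<zero>\<^bsub>?Z Quot ?B\<^esub>"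
    by (simp only: nilpotent_def cohomology_ring_def)
  then obtain k :: nat where k: "(?B +>\<^bsub>?Z\<^esub> f) [^]\<^bsub>?Z Quot ?B\<^esub> k = \<zero>\<^bsub>?Z Quot ?B\<^esub>"
    by (elim exE)
  have "\<zero>\<^bsub>?Z Quot ?B\<^esub> = ?B" by (simp only: FactRing_def ring.simps)
  then have "?B +>\<^bsub>?Z\<^esub> (f [^]\<^bsub>?Z\<^esub> k) = ?B"
    using \<pi>.hom_nat_pow[OF f, of k] k by (simp only:)
  then have "f [^]\<^bsub>?Z\<^esub> k \<in> ?B"
    using B.rcos_const_imp_mem B.nat_pow_closed[OF f] by blast
  then have "eval (k * d) (f [^]\<^bsub>?Z\<^esub> k) = 0"
    using eval_coboundary by (auto simp: coboundaries_def)
  with eval_pow assms(3) show False by simp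
qed

end

subsection \<open>Transfer of powers of a character\<close>

locale finite_action = group G for G (structure) +
  fixes X :: "'x set" and act :: "'a \<Rightarrow> 'x \<Rightarrow> 'x"
  assumes finite_X: "finite X"
    and act_closed: "\<And>g x. g \<in> carrier G \<Longrightarrow> x \<in> X \<Longrightarrow> act g x \<in> X"
    and act_mult: "\<And>g k x. g \<in> carrier G \<Longrightarrow> k \<in> carrier G \<Longrightarrow> x \<in> X \<Longrightarrow> act (g \<otimes> k) x = act g (act k x)"
    and act_one: "\<And>x. x \<in> X \<Longrightarrow> act \<one> x = x"
begin

lemma foldr_act_closed: "set gs \<subseteq> carrier G \<Longrightarrow> x \<in> X \<Longrightarrow> foldr act gs x \<in> X"
  by (induction gs) (auto simp: act_closed)

lemma act_bij: "g \<in> carrier G \<Longrightarrow> bij_betw (act g) X X"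
  by (rule bij_betw_byWitness[where f' = "act (inv g)"])
     (auto simp: act_closed act_one simp flip: act_mult)

lemma foldr_act_face:
  assumes "set gs \<subseteq> carrier G" "x \<in> X" "0 < i" "i < length gs"
  shows "foldr act (face G i gs) x = foldr act gs x"
  using assms
proof (induction gs arbitrary: i)
  case (Cons g gs)
  then obtain k ks where gs: "gs = k # ks" by (cases gs) auto
  show ?case
  proof (cases "i = 1")
    case True
    then show ?thesis
      using Cons.prems gs by (simp add: face_def act_mult foldr_act_closed)
  next
    case False
    then obtain j where j: "i = Suc j" "0 < j" using Cons.prems by (cases i) auto
    then have "face G i (g # gs) = g # face G j gs"
      using Cons.prems by (auto simp: face_def nth_Cons' take_Cons' drop_Cons')
    then show ?thesis using Cons j by simp
  qed
qed simp

lemma foldr_act_butlast: "gs \<noteq> [] \<Longrightarrow> foldr act (butlast gs) (act (last gs) x) = foldr act gs x"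
  by (induction gs) auto

end

text \<open>
  The function eps is a 1-cocycle with values in the field of two elements on the action groupoid
  of X. The cochain transfer d is the image of its d-th cup power under the transfer to G.
\<close>

locale action_character = finite_action G X act for G (structure) and X :: "'x set" and act +
  fixes eps :: "'a \<Rightarrow> 'x \<Rightarrow> bit"
  assumes eps_mult: "\<And>g k x. g \<in> carrier G \<Longrightarrow> k \<in> carrier G \<Longrightarrow> x \<in> X \<Longrightarrow>
      eps (g \<otimes> k) x = eps g (act k x) + eps k x"
begin

text \<open>The cup power of the character along the path from \<open>x\<close> traced by the list.
  Lists act from their right end, so \<open>eps g\<close> is read at the point that the later
  entries have reached.\<close>

primrec weight :: "'x \<Rightarrow> 'a list \<Rightarrow> bit" where
  "weight x [] = 1"
| "weight x (g # gs) = eps g (foldr act gs x) * weight x gs"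

definition transfer :: "nat \<Rightarrow> 'a list \<Rightarrow> bit" where
  "transfer d gs = (if set gs \<subseteq> carrier G \<and> length gs = d then \<Sum>x\<in>X. weight x gs else 0)"

text \<open>
  Writing P i for the product of all factors of the weight but the i-th, the inner face i contributes
  P i + P (i + 1), and the two outer faces contribute P 1 and P n, so that everything cancels.
\<close>

lemma weight_faces:
  assumes "set gs \<subseteq> carrier G" "gs \<noteq> []" "x \<in> X"
  shows "(\<Sum>i<length gs. weight x (face G i gs)) = weight (act (last gs) x) (butlast gs)"
  using assms
proof (induction gs)
  case (Cons g gs)
  show ?case
  proof (cases gs)
    case Nil
    then show ?thesis by (simp add: face_def)
  next
    case (Cons k ks)
    note gs = this
    let ?n = "length ks" and ?W = "weight (act (last gs) x) (butlast gs)"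
    let ?S = "\<Sum>i<?n. weight x (face G (Suc i) gs)" and ?y = "foldr act gs x" and ?z = "foldr act ks x"
    have closed: "g \<in> carrier G" "k \<in> carrier G" "?z \<in> X"
      using Cons.prems gs by (auto intro: foldr_act_closed)
    \<comment> \<open>An inner face of \<open>gs\<close> multiplies two neighbours, which does not
      change the point \<open>?y\<close> where \<open>eps g\<close> is read.\<close>
    have "weight x (face G (Suc (Suc i)) (g # gs)) = eps g ?y * weight x (face G (Suc i) gs)"
      if "i < ?n" for i
    proof -
      have "face G (Suc (Suc i)) (g # gs) = g # face G (Suc i) gs"
        using that gs by (simp add: face_def)
      then show ?thesis using that Cons.prems gs by (simp add: foldr_act_face)
    qed
    then have "(\<Sum>i<?n. weight x (face G (Suc (Suc i)) (g # gs))) = eps g ?y * ?S"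
      by (simp add: sum_distrib_left)
    then have "(\<Sum>i<length (g # gs). weight x (face G i (g # gs))) =
        weight x gs + (eps (g \<otimes> k) ?z * weight x ks + eps g ?y * ?S)"
      using sum.lessThan_Suc_shift[of "\<lambda>i. weight x (face G i (g # gs))" "Suc ?n"]
        sum.lessThan_Suc_shift[of "\<lambda>i. weight x (face G (Suc i) (g # gs))" ?n] gs
      by (simp add: face_def del: sum.lessThan_Suc)
    moreover have "weight x ks + ?S = ?W"
      using Cons.IH Cons.prems gs sum.lessThan_Suc_shift[of "\<lambda>i. weight x (face G i gs)" ?n]
      by (simp add: face_def del: sum.lessThan_Suc)
    moreover have "weight x gs = eps k ?z * weight x ks" "eps (g \<otimes> k) ?z = eps g ?y + eps k ?z"
      using gs closed by (simp_all add: eps_mult)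
    moreover have "weight (act (last (g # gs)) x) (butlast (g # gs)) = eps g ?y * ?W"
      using foldr_act_butlast[of gs x] gs by simp
    moreover have "b * w + ((a + b) * w + a * s) = a * (w + s)" for a b w s :: bit
      by (cases a; cases b; cases w; cases s) simp_all
    ultimately show ?thesis by metis
  qed
qed simp

lemma transfer_homogeneous: "transfer d \<in> homogeneous_cochains G d"
  by (auto simp: transfer_def homogeneous_cochains_def split: if_splits)

text \<open>By \<open>weight_faces\<close>, all faces but the last add up to the weight of
  \<open>butlast gs\<close> started at \<open>act (last gs) x\<close> instead of \<open>x\<close>.
  Since \<open>last gs\<close> permutes \<open>X\<close>, summation over \<open>X\<close> removes
  the difference, and the last face cancels the rest.\<close>

lemma transfer_cocycle: "transfer d \<in> cocycles G"
proof -
  have "transfer d \<in> cochains G"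
    using transfer_homogeneous unfolding cochains_def homogeneous_cochains_def by fastforce
  moreover have "coboundary G (transfer d) gs = 0" for gs
  proof (cases "gs \<noteq> [] \<and> set gs \<subseteq> carrier G \<and> length gs = Suc d")
    case True
    then have gs: "gs \<noteq> []" "set gs \<subseteq> carrier G" "length gs = Suc d" "last gs \<in> carrier G" by auto
    have "face G (length gs) gs = butlast gs" using gs(1) by (simp add: face_def)
    moreover have "transfer d (face G i gs) = (\<Sum>x\<in>X. weight x (face G i gs))" if "i \<le> length gs" for i
      using that gs length_face[of i gs G] face_closed[of i gs] by (simp add: transfer_def)
    ultimately have "coboundary G (transfer d) gs =
        (\<Sum>i<length gs. \<Sum>x\<in>X. weight x (face G i gs)) + (\<Sum>x\<in>X. weight x (butlast gs))"
      using gs by (simp add: coboundary_def flip: lessThan_Suc_atMost)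
    also have "(\<Sum>x\<in>X. weight x (butlast gs)) = (\<Sum>x\<in>X. weight (act (last gs) x) (butlast gs))"
      by (rule sum.reindex_bij_betw[OF act_bij[OF gs(4)], symmetric])
    also have "\<dots> = (\<Sum>i<length gs. \<Sum>x\<in>X. weight x (face G i gs))"
      using gs(1,2) by (subst sum.swap) (simp add: weight_faces)
    finally show ?thesis by (simp only: bit_add_self)
  next
    case False
    then have "transfer d (face G i gs) = 0" if "gs \<noteq> []" "set gs \<subseteq> carrier G" "i \<le> length gs" for i
      using that length_face[of i gs G] by (cases gs) (auto simp: transfer_def)
    then show ?thesis by (simp add: coboundary_def)
  qed
  ultimately show ?thesis by (auto simp: cocycles_def)
qed

end

section \<open>Pairing the points moved by commuting involutions\<close>

locale action_involutions = finite_action G X act + commuting_involutions G J h r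
  for G :: "('a, 'b) monoid_scheme" (structure) and X :: "'x set" and act
    and J :: "'i::wellorder set" and h r
begin

definition fixed :: "'x set" where
  "fixed = {x \<in> X. \<forall>a\<in>J. act (h a) x = x}"

text \<open>Since the involutions commute, those that move a point are the same along its whole
  orbit. Taking the least index therefore gives one mover per orbit, so that \<open>move\<close> is
  an involution on the non-fixed points and commutes with every \<open>act (h a)\<close>.\<close>

definition mover :: "'x \<Rightarrow> 'i" where
  "mover x = (LEAST a. a \<in> J \<and> act (h a) x \<noteq> x)"

definition move :: "'x \<Rightarrow> 'x" where
  "move x = act (h (mover x)) x"

lemma mover:
  assumes "x \<in> X - fixed"
  shows "mover x \<in> J" "move x \<noteq> x"
proof -
  have "\<exists>a. a \<in> J \<and> act (h a) x \<noteq> x" using assms by (auto simp: fixed_def)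
  from LeastI_ex[OF this] show "mover x \<in> J" "move x \<noteq> x"
    by (auto simp: mover_def move_def)
qed

lemma act_h_commute:
  assumes "a \<in> J" "b \<in> J" "x \<in> X"
  shows "act (h a) (act (h b) x) = act (h b) (act (h a) x)"
  using assms by (metis act_mult h_closed h_commute)

lemma act_h_square: "a \<in> J \<Longrightarrow> x \<in> X \<Longrightarrow> act (h a) (act (h a) x) = x"
  by (metis act_mult act_one h_closed h_square)

lemma act_h_closed: "a \<in> J \<Longrightarrow> x \<in> X \<Longrightarrow> act (h a) x \<in> X"
  by (simp add: act_closed h_closed)

lemma act_h_moved:
  assumes "a \<in> J" "x \<in> X - fixed"
  shows "act (h a) x \<in> X - fixed" "mover (act (h a) x) = mover x"
proof -
  have *: "act (h b) (act (h a) x) \<noteq> act (h a) x \<longleftrightarrow> act (h b) x \<noteq> x" if "b \<in> J" for b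
    using assms that act_h_commute act_h_square act_h_closed by (metis DiffD1)
  show "act (h a) x \<in> X - fixed"
    using assms * by (auto simp: fixed_def act_h_closed)
  show "mover (act (h a) x) = mover x"
    unfolding mover_def using * by (metis (lifting))
qed

lemma move_involution:
  assumes "x \<in> X - fixed"
  shows "move x \<in> X - fixed" "move (move x) = x"
  using assms act_h_moved[OF mover(1)] act_h_square[OF mover(1)] by (auto simp: move_def)

lemma act_h_move:
  assumes "a \<in> J" "x \<in> X - fixed"
  shows "act (h a) (move x) = move (act (h a) x)"
  using assms act_h_moved act_h_commute mover(1) by (simp add: move_def)

end

locale action_character_involutions =
  action_character G X act eps + action_involutions G X act J h r
  for G :: "('a, 'b) monoid_scheme" (structure) and X :: "'x set" and act eps
    and J :: "'i::wellorder set" and h r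
begin

text \<open>
  If the character is trivial on the chosen involution of the non-fixed points, then the
  contributions of x and move x agree, so that only the fixed points matter.
\<close>

lemma eval_transfer:
  assumes move: "\<And>x. x \<in> X - fixed \<Longrightarrow> eps (h (mover x)) x = 0"
  shows "eval d (transfer d) = (\<Sum>x\<in>fixed. (\<Sum>a\<in>J. r a * [:eps (h a) x:]) ^ d)"
proof -
  have "eval d (transfer d) = eval d (\<lambda>gs. \<Sum>x\<in>X. weight x gs)"
    using h_closed by (intro eval_cong) (auto simp: transfer_def)
  also have "\<dots> = (\<Sum>x\<in>X. eval d (weight x))" by (rule eval_sum)
  also have "\<dots> = (\<Sum>x\<in>X - fixed. eval d (weight x)) + (\<Sum>x\<in>fixed. eval d (weight x))"
    using finite_X by (intro sum.subset_diff) (auto simp: fixed_def)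
  also have "(\<Sum>x\<in>X - fixed. eval d (weight x)) = 0"
  proof (rule sum_free_involution_char2[where \<sigma> = move])
    fix x assume x: "x \<in> X - fixed"
    show "eval d (weight (move x)) = eval d (weight x)"
    proof (rule eval_cong)
      fix as assume "set as \<subseteq> J"
      then have "weight (move x) (map h as) = weight x (map h as) \<and>
          foldr act (map h as) x \<in> X - fixed \<and>
          foldr act (map h as) (move x) = move (foldr act (map h as) x)"
      proof (induction as)
        case (Cons a as)
        let ?y = "foldr act (map h as) x"
        let ?b = "mover ?y"
        have a: "a \<in> J" and y: "?y \<in> X - fixed" using Cons by auto
        have b: "?b \<in> J" by (rule mover[OF y])
        \<comment> \<open>The cocycle rule is applied to both orders of \<open>h a\<close> and
          \<open>h ?b\<close>. The points \<open>?y\<close> and \<open>act (h a) ?y\<close> share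
          the mover \<open>?b\<close>, on which \<open>eps\<close> vanishes at both.\<close>
        have "eps (h a) (move ?y) + 0 = eps (h a) (move ?y) + eps (h ?b) ?y"
          using move[OF y] by simp
        also have "\<dots> = eps (h a \<otimes> h ?b) ?y"
          using y a b by (simp add: eps_mult h_closed move_def)
        also have "h a \<otimes> h ?b = h ?b \<otimes> h a" by (rule h_commute[OF a b])
        also have "eps (h ?b \<otimes> h a) ?y = eps (h ?b) (act (h a) ?y) + eps (h a) ?y"
          using y a b by (simp add: eps_mult h_closed)
        also have "eps (h ?b) (act (h a) ?y) = 0"
          using move[OF act_h_moved(1)[OF a y]] act_h_moved(2)[OF a y] by simp
        finally have "eps (h a) (move ?y) = eps (h a) ?y" by simp
        then show ?case using Cons act_h_moved(1)[OF a y] act_h_move[OF a y] by simp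
      qed (use x in simp)
      then show "weight (move x) (map h as) = weight x (map h as)" by simp
    qed
  qed (use finite_X move_involution mover in \<open>auto simp: bit_poly_add_self\<close>)
  also have "(\<Sum>x\<in>fixed. eval d (weight x)) = (\<Sum>x\<in>fixed. (\<Sum>a\<in>J. r a * [:eps (h a) x:]) ^ d)"
  proof (rule sum.cong[OF refl])
    fix x assume x: "x \<in> fixed"
    have fix_word: "foldr act (map h as) x = x" if "set as \<subseteq> J" for as
      using that x by (induction as) (auto simp: fixed_def)
    show "eval d (weight x) = (\<Sum>a\<in>J. r a * [:eps (h a) x:]) ^ d"
    proof (induction d)
      case 0
      show ?case by (simp add: one_pCons)
    next
      case (Suc d)
      have "eval d (\<lambda>gs. weight x (h a # gs)) = [:eps (h a) x:] * eval d (weight x)" if "a \<in> J" for a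
        unfolding eval_scale[symmetric] using fix_word by (intro eval_cong) simp
      then show ?case
        by (simp only: eval.simps Suc.IH power_Suc sum_distrib_right mult.assoc cong: sum.cong)
    qed
  qed
  finally show ?thesis by simp
qed

end

subsection \<open>Power sums over the linear forms\<close>

lemma CHAR_bit: "CHAR(bit) = 2"
proof (rule CHAR_eq_posI)
  fix c :: nat assume "0 < c" "c < 2"
  then have "c = 1" by simp
  then show "of_nat c \<noteq> (0::bit)" by simp
qed simp_all

text \<open>
  Kronecker's substitution y i = X^(2^(m * i)) separates the monomials: if every binary digit j of d
  is below m, then the product over j of (y (\<kappa> j))^(2^j) has exponent the sum of all 2^(m * \<kappa> j + j),
  which determines \<kappa>. The monomial of \<kappa> occurs once for every S containing the image of \<kappa>,
  hence exactly once if \<kappa> is surjective.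
\<close>

lemma power_sum_linear_forms_nonzero:
  assumes "0 < n" "n \<le> card {i. bit d i}"
  shows "\<exists>y :: nat \<Rightarrow> bit poly. (\<Sum>S\<in>Pow {..<n}. (\<Sum>i\<in>S. y i) ^ d) \<noteq> 0"
proof -
  define D where "D = set_decode d"
  have D_bits: "{i. bit d i} = D" by (simp add: D_def set_decode_def bit_iff_odd)
  have fin: "finite D" by (simp add: D_def)
  have d: "d = (\<Sum>j\<in>D. 2 ^ j)"
    using set_decode_inverse[of d] by (simp add: D_def set_encode_def)
  obtain m where m: "D \<subseteq> {..<m}" using fin by (meson finite_nat_bounded)
  define y :: "nat \<Rightarrow> bit poly" where "y i = monom 1 (2 ^ (m * i))" for i
  define code where "code \<kappa> = (\<lambda>j. m * \<kappa> j + j) ` D" for \<kappa> :: "nat \<Rightarrow> nat"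
  \<comment> \<open>Division by \<open>m\<close> recovers \<open>j\<close> as remainder and
    \<open>\<kappa> j\<close> as quotient, because \<open>D\<close> lies below \<open>m\<close>. So
    the binary digits of the exponent are distinct and do not carry.\<close>
  have inj_code: "inj_on (\<lambda>j. m * \<kappa> j + j) D" for \<kappa> :: "nat \<Rightarrow> nat"
  proof (rule inj_onI)
    fix j k assume jk: "j \<in> D" "k \<in> D" "m * \<kappa> j + j = m * \<kappa> k + k"
    then have "(m * \<kappa> j + j) mod m = (m * \<kappa> k + k) mod m" by simp
    moreover have "j < m" "k < m" using jk m by auto
    ultimately show "j = k" by simp
  qed
  have code_eqD: "\<kappa> j = \<mu> j" if "code \<kappa> = code \<mu>" "j \<in> D" for \<kappa> \<mu> :: "nat \<Rightarrow> nat" and j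
  proof -
    have "m * \<kappa> j + j \<in> code \<mu>" using that by (auto simp: code_def)
    then obtain k where k: "k \<in> D" "m * \<kappa> j + j = m * \<mu> k + k" by (auto simp: code_def)
    then have "(m * \<kappa> j + j) mod m = (m * \<mu> k + k) mod m" by simp
    moreover have "j < m" "k < m" using k that m by auto
    ultimately have "j = k" by simp
    then show ?thesis using k(2) \<open>j < m\<close> by simp
  qed
  have "(\<Sum>i\<in>S. y i) ^ d = (\<Sum>\<kappa>\<in>D \<rightarrow>\<^sub>E S. monom 1 (set_encode (code \<kappa>)))" if "finite S" for S
  proof -
    have "(\<Sum>i\<in>S. y i) ^ d = (\<Prod>j\<in>D. (\<Sum>i\<in>S. y i) ^ (2 ^ j))"
      unfolding d by (rule power_sum)
    also have "\<dots> = (\<Prod>j\<in>D. \<Sum>i\<in>S. monom 1 (2 ^ (m * i + j)))"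
    proof (rule prod.cong[OF refl])
      fix j
      have "(\<Sum>i\<in>S. y i) ^ (2 ^ j) = (\<Sum>i\<in>S. y i ^ (2 ^ j))"
        by (rule freshmans_dream_sum'[where n = j]) (simp_all add: CHAR_bit)
      then show "(\<Sum>i\<in>S. y i) ^ (2 ^ j) = (\<Sum>i\<in>S. monom 1 (2 ^ (m * i + j)))"
        by (simp add: y_def monom_power power_add)
    qed
    also have "\<dots> = (\<Sum>\<kappa>\<in>D \<rightarrow>\<^sub>E S. \<Prod>j\<in>D. monom 1 (2 ^ (m * \<kappa> j + j)))"
      by (rule prod_sum_PiE) (use fin that in auto)
    also have "\<dots> = (\<Sum>\<kappa>\<in>D \<rightarrow>\<^sub>E S. monom 1 (set_encode (code \<kappa>)))"
    proof (rule sum.cong[OF refl])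
      fix \<kappa> :: "nat \<Rightarrow> nat"
      have "(\<Prod>j\<in>D. monom (1::bit) (2 ^ (m * \<kappa> j + j))) = monom 1 (\<Sum>j\<in>D. 2 ^ (m * \<kappa> j + j))"
        using fin by (induction D) (auto simp: mult_monom)
      then show "(\<Prod>j\<in>D. monom (1::bit) (2 ^ (m * \<kappa> j + j))) = monom 1 (set_encode (code \<kappa>))"
        using inj_code[of \<kappa>]
        by (simp add: set_encode_def code_def sum.reindex)
    qed
    finally show ?thesis .
  qed
  then have expand: "(\<Sum>S\<in>Pow {..<n}. (\<Sum>i\<in>S. y i) ^ d) =
      (\<Sum>S\<in>Pow {..<n}. \<Sum>\<kappa>\<in>D \<rightarrow>\<^sub>E S. monom 1 (set_encode (code \<kappa>)))"
    by (intro sum.cong refl) (auto intro: finite_subset)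
  \<comment> \<open>The number of binary ones enters here: \<open>n \<le> card D\<close> provides a
    surjection of \<open>D\<close> onto \<open>{..<n}\<close>.\<close>
  obtain \<phi> where "\<phi> ` {..<n} \<subseteq> D" "inj_on \<phi> {..<n}"
    using card_le_inj[of "{..<n}" D] fin assms D_bits by auto
  moreover have "{..<n} \<noteq> {}" using \<open>0 < n\<close> by auto
  ultimately obtain g where "g ` D = {..<n}"
    using inj_on_iff_surj[of "{..<n}" D] by blast
  then obtain \<kappa> where \<kappa>: "\<kappa> ` D = {..<n}" "\<kappa> \<in> extensional D"
    by (metis image_restrict_eq restrict_extensional)
  have coeff: "(\<Sum>\<mu>\<in>D \<rightarrow>\<^sub>E S. coeff (monom (1::bit) (set_encode (code \<mu>))) (set_encode (code \<kappa>))) =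
      (if S = {..<n} then 1 else 0)" if "S \<subseteq> {..<n}" for S
  proof -
    have "finite (D \<rightarrow>\<^sub>E S)" using fin that by (auto intro!: finite_PiE intro: finite_subset)
    have "code \<mu> = code \<kappa> \<longleftrightarrow> \<mu> = \<kappa>" if "\<mu> \<in> D \<rightarrow>\<^sub>E S" for \<mu>
      using that code_eqD[of \<mu> \<kappa>] \<kappa>(2) by (metis PiE_iff extensionalityI)
    then have "(\<Sum>\<mu>\<in>D \<rightarrow>\<^sub>E S. coeff (monom (1::bit) (set_encode (code \<mu>))) (set_encode (code \<kappa>))) =
        (\<Sum>\<mu>\<in>D \<rightarrow>\<^sub>E S. if \<mu> = \<kappa> then 1 else 0)"
      by (intro sum.cong refl) (simp add: set_encode_eq code_def fin)
    also have "\<dots> = (if \<kappa> \<in> D \<rightarrow>\<^sub>E S then 1 else 0)"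
      using \<open>finite (D \<rightarrow>\<^sub>E S)\<close> by simp
    also have "\<kappa> \<in> D \<rightarrow>\<^sub>E S \<longleftrightarrow> \<kappa> ` D \<subseteq> S"
      using \<kappa>(2) by (auto simp: PiE_iff)
    also have "\<kappa> ` D \<subseteq> S \<longleftrightarrow> S = {..<n}"
      using \<kappa>(1) that by blast
    finally show ?thesis .
  qed
  have "coeff (\<Sum>S\<in>Pow {..<n}. (\<Sum>i\<in>S. y i) ^ d) (set_encode (code \<kappa>)) =
      (\<Sum>S\<in>Pow {..<n}. if S = {..<n} then 1 else 0)"
    unfolding expand coeff_sum by (intro sum.cong refl coeff) auto
  also have "\<dots> = 1" by simp
  finally show ?thesis by (metis coeff_0 zero_neq_one)
qed

subsection \<open>Two-element subsets of a permutation representation\<close>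

definition two_subsets :: "'v set \<Rightarrow> 'v set set" where
  "two_subsets V = {A. A \<subseteq> V \<and> card A = 2}"

lemma two_subsets_eqI:
  assumes "card A = 2" "v \<in> A" "w \<in> A" "v \<noteq> w" "u \<in> A" "u \<noteq> v"
  shows "u = w"
  using assms by (auto simp: card_2_iff)

context finite_action
begin

lemma act_inj: "g \<in> carrier G \<Longrightarrow> inj_on (act g) X"
  using act_bij by (rule bij_betw_imp_inj_on)

lemma finite_action_two_subsets: "finite_action G (two_subsets X) (\<lambda>g A. act g ` A)"
proof
  show "finite (two_subsets X)"
    using finite_X by (auto simp: two_subsets_def intro: finite_subset[of _ "Pow X"])
  fix g A assume g: "g \<in> carrier G" and A: "A \<in> two_subsets X"
  then have "A \<subseteq> X" "card A = 2" by (auto simp: two_subsets_def)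
  moreover have "card (act g ` A) = card A"
    by (rule card_image[OF inj_on_subset[OF act_inj[OF g] \<open>A \<subseteq> X\<close>]])
  ultimately show "act g ` A \<in> two_subsets X"
    using act_closed[OF g] by (auto simp: two_subsets_def)
next
  fix g k A assume gk: "g \<in> carrier G" "k \<in> carrier G" and "A \<in> two_subsets X"
  then have "A \<subseteq> X" by (simp add: two_subsets_def)
  then show "act (g \<otimes> k) ` A = act g ` act k ` A"
    unfolding image_image using act_mult[OF gk] by (intro image_cong) auto
next
  fix A assume "A \<in> two_subsets X"
  then have "A \<subseteq> X" by (simp add: two_subsets_def)
  then have "act \<one> ` A = id ` A" using act_one by (intro image_cong) auto
  then show "act \<one> ` A = A" by simp
qed

text \<open>
  The pointed two-element subsets form a double cover of the two-element subsets. The choice s of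
  a sheet turns the double cover into a cocycle.
\<close>

lemma action_character_two_subsets:
  assumes s: "\<And>A. A \<in> two_subsets X \<Longrightarrow> s A \<in> A"
  shows "action_character G (two_subsets X) (\<lambda>g A. act g ` A)
    (\<lambda>g A. of_bool (act g (s A) \<noteq> s (act g ` A)))"
proof -
  interpret two: finite_action G "two_subsets X" "\<lambda>g A. act g ` A"
    by (rule finite_action_two_subsets)
  show ?thesis
  proof
    fix g k A assume g: "g \<in> carrier G" and k: "k \<in> carrier G" and A: "A \<in> two_subsets X"
    define v w u where "v = act k (s A)" and "w = s (act k ` A)" and "u = s (act g ` act k ` A)"
    have B: "act k ` A \<in> two_subsets X" and C: "act g ` act k ` A \<in> two_subsets X"
      using g k A two.act_closed by auto
    have vw: "v \<in> act k ` A" "w \<in> act k ` A" using s A B by (auto simp: v_def w_def)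
    then have vw_X: "v \<in> X" "w \<in> X" using B by (auto simp: two_subsets_def)
    have u: "u \<in> act g ` act k ` A" using s C by (simp add: u_def)
    \<comment> \<open>If \<open>v \<noteq> w\<close>, exactly one of \<open>act g v\<close> and
      \<open>act g w\<close> is \<open>u\<close>, so passing from \<open>v\<close> to
      \<open>w\<close> flips the condition.\<close>
    have "of_bool (act g v \<noteq> u) = (of_bool (act g w \<noteq> u) + of_bool (v \<noteq> w) :: bit)"
    proof (cases "v = w")
      case False
      then have "act g v \<noteq> act g w" using act_inj[OF g] vw_X by (auto dest: inj_onD)
      moreover have "u = act g w" if "u \<noteq> act g v"
        using two_subsets_eqI[of "act g ` act k ` A" "act g v" "act g w" u] that calculation vw u C
        by (auto simp: two_subsets_def)
      ultimately show ?thesis using False by auto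
    qed simp
    moreover have "act (g \<otimes> k) (s A) = act g v" "act (g \<otimes> k) ` A = act g ` act k ` A"
      using g k A s[OF A] two.act_mult by (auto simp: v_def act_mult two_subsets_def)
    ultimately show "of_bool (act (g \<otimes> k) (s A) \<noteq> s (act (g \<otimes> k) ` A)) =
        (of_bool (act g (s (act k ` A)) \<noteq> s (act g ` act k ` A)) +
         of_bool (act k (s A) \<noteq> s (act k ` A)) :: bit)"
      by (simp add: u_def v_def w_def)
  qed
qed

end

text \<open>\<open>eval_transfer\<close> needs a character that vanishes on movers, so the points
  \<open>s\<close> are chosen such that the mover of \<open>A\<close> carries \<open>s A\<close> to
  \<open>s (two.move A)\<close>. On a fixed subset the character is independent of \<open>s\<close>:
  it records whether \<open>h a\<close> swaps the two points.\<close>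

lemma (in action_involutions) exists_cocycle_two_subsets:
  defines "F \<equiv> {A \<in> two_subsets X. \<forall>a\<in>J. act (h a) ` A = A}"
  shows "\<exists>f \<in> cocycles G \<inter> homogeneous_cochains G d.
    eval d f = (\<Sum>A\<in>F. (\<Sum>a\<in>J. r a * [:of_bool (\<exists>v\<in>A. act (h a) v \<noteq> v):]) ^ d)"
proof -
  interpret two: finite_action G "two_subsets X" "\<lambda>g A. act g ` A"
    by (rule finite_action_two_subsets)
  interpret two: action_involutions G "two_subsets X" "\<lambda>g A. act g ` A" J h r ..
  define q :: "'x set \<Rightarrow> 'x" where "q A = (SOME v. v \<in> A)" for A
  \<comment> \<open>The choice depends only on the unordered pair, so both partners get the same
    representative. The representative keeps its point \<open>q\<close>; its partner receives the
    image of that point under the common mover.\<close>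
  define rep where "rep A = (SOME B. B \<in> {A, two.move A})" for A
  define s where "s A = (if A \<in> two_subsets X - two.fixed \<and> A \<noteq> rep A
      then act (h (two.mover A)) (q (two.move A)) else q A)" for A
  have q: "q A \<in> A" if "A \<in> two_subsets X" for A
    using that unfolding q_def by (auto simp: two_subsets_def some_in_eq)
  have rep_move: "rep (two.move A) = rep A" if "A \<in> two_subsets X - two.fixed" for A
    using two.move_involution[OF that] by (simp add: rep_def insert_commute)
  have rep: "rep A = A \<or> rep A = two.move A" for A
    using some_in_eq[of "{A, two.move A}"] by (auto simp: rep_def)
  have s_in: "s A \<in> A" if A: "A \<in> two_subsets X" for A
  proof (cases "A \<in> two_subsets X - two.fixed \<and> A \<noteq> rep A")
    case True
    then have "q (two.move A) \<in> two.move A" using q two.move_involution by blast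
    then have "s A \<in> act (h (two.mover A)) ` two.move A" using True by (auto simp: s_def)
    also have "\<dots> = A"
      using True two.mover two.act_h_square by (auto simp: two.move_def)
    finally show ?thesis .
  qed (use q A in \<open>auto simp: s_def\<close>)
  have s_move: "act (h (two.mover A)) (s A) = s (two.move A)" if A: "A \<in> two_subsets X - two.fixed" for A
  proof -
    note inv = two.move_involution[OF A] and b = two.mover[OF A]
    have mm: "two.mover (two.move A) = two.mover A"
      using two.act_h_moved(2)[OF b(1) A] by (simp add: two.move_def)
    have "q (two.move A) \<in> X" using q inv(1) by (auto simp: two_subsets_def)
    show ?thesis
    proof (cases "rep A = A")
      case True
      then have "s A = q A" "s (two.move A) = act (h (two.mover A)) (q A)"
        using inv b(2) mm rep_move[OF A] by (simp_all add: s_def)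
      then show ?thesis by simp
    next
      case False
      then have "s A = act (h (two.mover A)) (q (two.move A))" "s (two.move A) = q (two.move A)"
        using A rep[of A] rep_move[OF A] by (simp_all add: s_def)
      then show ?thesis using act_h_square[OF b(1) \<open>q (two.move A) \<in> X\<close>] by simp
    qed
  qed
  interpret two: action_character G "two_subsets X" "\<lambda>g A. act g ` A"
    "\<lambda>g A. of_bool (act g (s A) \<noteq> s (act g ` A))"
    by (rule action_character_two_subsets[OF s_in])
  interpret two: action_character_involutions G "two_subsets X" "\<lambda>g A. act g ` A"
    "\<lambda>g A. of_bool (act g (s A) \<noteq> s (act g ` A))" J h r ..
  have "eval d (two.transfer d) = (\<Sum>A\<in>two.fixed. (\<Sum>a\<in>J. r a *
      [:of_bool (act (h a) (s A) \<noteq> s (act (h a) ` A)):]) ^ d)"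
    by (rule two.eval_transfer) (simp add: s_move flip: two.move_def)
  also have "two.fixed = F" by (auto simp: F_def two.fixed_def)
  also have "(\<Sum>A\<in>F. (\<Sum>a\<in>J. r a * [:of_bool (act (h a) (s A) \<noteq> s (act (h a) ` A)):]) ^ d) =
      (\<Sum>A\<in>F. (\<Sum>a\<in>J. r a * [:of_bool (\<exists>v\<in>A. act (h a) v \<noteq> v):]) ^ d)"
  proof (intro sum.cong refl arg_cong[where f = "\<lambda>p. p ^ d"])
    fix A a assume A: "A \<in> F" and a: "a \<in> J"
    have "A \<in> two_subsets X" and fix_A: "act (h a) ` A = A" using A a by (auto simp: F_def)
    then have A2: "s A \<in> A" "card A = 2" "A \<subseteq> X" using s_in by (auto simp: two_subsets_def)
    have "act (h a) v = v" if v: "v \<in> A" and s: "act (h a) (s A) = s A" for v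
    proof (rule ccontr)
      assume ne: "act (h a) v \<noteq> v"
      have "act (h a) v \<noteq> s A"
      proof
        assume "act (h a) v = s A"
        then have "v = s A"
          using act_inj[OF h_closed[OF a]] v s A2 by (metis inj_onD subsetD)
        then show False using ne s by simp
      qed
      moreover have "act (h a) v \<in> A" using fix_A v by blast
      ultimately show False
        using two_subsets_eqI[of A "s A" v "act (h a) v"] A2 v ne s by metis
    qed
    then have "act (h a) (s A) \<noteq> s A \<longleftrightarrow> (\<exists>v\<in>A. act (h a) v \<noteq> v)" using A2(1) by blast
    then show "r a * [:of_bool (act (h a) (s A) \<noteq> s (act (h a) ` A)):] =
        r a * [:of_bool (\<exists>v\<in>A. act (h a) v \<noteq> v):]"
      by (simp add: fix_A)
  qed
  finally show ?thesis
    by (rule bexI[OF _ IntI[OF two.transfer_cocycle two.transfer_homogeneous]])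
qed

subsection \<open>Commuting involutions in the general linear group\<close>

text \<open>
  Identify the basis vector with index A with the squarefree monomial whose variables are the
  binary digits of A. These monomials form a down-closed set for A < N, and the involution below
  translates the i-th variable by 1.
\<close>

definition shear :: "nat \<Rightarrow> nat \<Rightarrow> bit mat" where
  "shear N i = mat N N (\<lambda>(B, A). of_bool (A = B \<or> \<not> bit B i \<and> A = B + 2 ^ i))"

lemma bit_add_power2: "\<not> bit B i \<Longrightarrow> bit (B + 2 ^ i) j \<longleftrightarrow> bit B j \<or> j = i" for B :: nat
  using bit_set_bit_iff[of i B j] by (auto simp: set_bit_eq)

lemma bit_nat_decompose:
  assumes "bit (A :: nat) i"
  obtains B where "\<not> bit B i" "A = B + 2 ^ i"
proof
  show "\<not> bit (unset_bit i A) i" by (simp add: bit_unset_bit_iff)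
  have "set_bit i (unset_bit i A) = A"
    using assms by (intro bit_eqI) (auto simp: bit_set_bit_iff bit_unset_bit_iff)
  then show "A = unset_bit i A + 2 ^ i"
    by (simp add: set_bit_eq bit_unset_bit_iff)
qed

lemma shear_carrier [simp]: "shear N i \<in> carrier_mat N N"
  by (simp add: shear_def)

lemma shear_dim [simp]: "dim_row (shear N i) = N" "dim_col (shear N i) = N"
  by (simp_all add: shear_def)

lemma shear_index:
  assumes "B < N" "A < N"
  shows "shear N i $$ (B, A) = of_bool (A = B) + of_bool (\<not> bit B i \<and> A = B + 2 ^ i)"
  using assms by (cases "A = B") (simp_all add: shear_def)

text \<open>On squarefree polynomials over F_2, translating the i-th variable by 1 adds the i-th
  partial derivative; the second summand is its coefficient at \<open>B\<close>.\<close>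

lemma shear_mult_vec:
  assumes "v \<in> carrier_vec N" "B < N"
  shows "(shear N i *\<^sub>v v) $ B = v $ B + (if \<not> bit B i \<and> B + 2 ^ i < N then v $ (B + 2 ^ i) else 0)"
proof -
  have "(shear N i *\<^sub>v v) $ B = (\<Sum>A\<in>{0..<N}. shear N i $$ (B, A) * v $ A)"
    using assms by (simp add: scalar_prod_def)
  also have "\<dots> = (\<Sum>A\<in>{0..<N}. (if A = B then v $ A else 0) +
      (if A = B + 2 ^ i then if bit B i then 0 else v $ A else 0))"
  proof (rule sum.cong[OF refl])
    fix A assume "A \<in> {0..<N}"
    then have "shear N i $$ (B, A) = of_bool (A = B) + of_bool (\<not> bit B i \<and> A = B + 2 ^ i)"
      using assms(2) by (intro shear_index) auto
    then show "shear N i $$ (B, A) * v $ A = (if A = B then v $ A else 0) +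
        (if A = B + 2 ^ i then if bit B i then 0 else v $ A else 0)"
      by (cases "A = B"; cases "A = B + 2 ^ i"; cases "bit B i") simp_all
  qed
  also have "\<dots> = v $ B + (if \<not> bit B i \<and> B + 2 ^ i < N then v $ (B + 2 ^ i) else 0)"
    using assms(2) unfolding sum.distrib by (simp add: sum.delta)
  finally show ?thesis .
qed

lemma shear_mult_mat:
  assumes "M \<in> carrier_mat N N" "B < N" "C < N"
  shows "(shear N i * M) $$ (B, C) =
    M $$ (B, C) + (if \<not> bit B i \<and> B + 2 ^ i < N then M $$ (B + 2 ^ i, C) else 0)"
proof -
  have "(shear N i * M) $$ (B, C) = (shear N i *\<^sub>v col M C) $ B"
    using assms by simp
  also have "\<dots> = col M C $ B + (if \<not> bit B i \<and> B + 2 ^ i < N then col M C $ (B + 2 ^ i) else 0)"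
    using assms by (intro shear_mult_vec) auto
  finally show ?thesis using assms by simp
qed

text \<open>The summands record a monomial kept, stripped of variable \<open>j\<close>, of
  \<open>i\<close>, or of both. Exchanging \<open>i\<close> and \<open>j\<close> only permutes them,
  and for \<open>i = j\<close> the last one drops out while the two before it cancel.\<close>

lemma shear_mult_shear:
  assumes "B < N" "C < N"
  shows "(shear N i * shear N j) $$ (B, C) = of_bool (C = B) +
    (of_bool (\<not> bit B j \<and> C = B + 2 ^ j) + of_bool (\<not> bit B i \<and> C = B + 2 ^ i) +
     of_bool (i \<noteq> j \<and> \<not> bit B i \<and> \<not> bit B j \<and> C = B + (2 ^ i + 2 ^ j)))"
proof -
  have "(if \<not> bit B i \<and> B + 2 ^ i < N then shear N j $$ (B + 2 ^ i, C) else 0) =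
    of_bool (\<not> bit B i \<and> C = B + 2 ^ i) +
     of_bool (i \<noteq> j \<and> \<not> bit B i \<and> \<not> bit B j \<and> C = B + (2 ^ i + 2 ^ j))"
  proof (cases "\<not> bit B i \<and> B + 2 ^ i < N")
    case True
    then show ?thesis
      using assms(2) by (simp add: shear_index bit_add_power2 eq_commute[of i j] conj_commute add.assoc)
  next
    case False
    then show ?thesis using assms(2) by auto
  qed
  then show ?thesis
    by (simp only: shear_mult_mat[OF shear_carrier assms] shear_index[OF assms] add.assoc)
qed

lemma shear_commute: "shear N i * shear N j = shear N j * shear N i"
proof (rule eq_matI)
  fix B C assume "B < dim_row (shear N j * shear N i)" "C < dim_col (shear N j * shear N i)"
  then have "B < N" "C < N" by simp_all
  moreover have "of_bool (i \<noteq> j \<and> \<not> bit B i \<and> \<not> bit B j \<and> C = B + (2 ^ i + 2 ^ j)) =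
      (of_bool (j \<noteq> i \<and> \<not> bit B j \<and> \<not> bit B i \<and> C = B + (2 ^ j + 2 ^ i)) :: bit)"
    by (rule arg_cong[where f = of_bool]) (auto simp: add.commute)
  ultimately show "(shear N i * shear N j) $$ (B, C) = (shear N j * shear N i) $$ (B, C)"
    by (simp only: shear_mult_shear add.commute[of "of_bool (\<not> bit B j \<and> C = B + 2 ^ j)"])
qed simp_all

lemma shear_square: "shear N i * shear N i = 1\<^sub>m N"
proof (rule eq_matI)
  fix B C assume "B < dim_row (1\<^sub>m N :: bit mat)" "C < dim_col (1\<^sub>m N :: bit mat)"
  then have "B < N" "C < N" by simp_all
  then show "(shear N i * shear N i) $$ (B, C) = 1\<^sub>m N $$ (B, C)"
    by (simp add: shear_mult_shear bit_add_self eq_commute[of B] del: index_mult_mat)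
qed simp_all

lemma shear_fixed_iff:
  assumes "v \<in> carrier_vec N"
  shows "shear N i *\<^sub>v v = v \<longleftrightarrow> (\<forall>B. \<not> bit B i \<and> B + 2 ^ i < N \<longrightarrow> v $ (B + 2 ^ i) = 0)"
proof -
  have "shear N i *\<^sub>v v = v \<longleftrightarrow> (\<forall>B<N. (shear N i *\<^sub>v v) $ B = v $ B)"
    using assms by (metis carrier_vecD dim_mult_mat_vec eq_vecI shear_dim(1))
  also have "\<dots> \<longleftrightarrow> (\<forall>B. \<not> bit B i \<and> B + 2 ^ i < N \<longrightarrow> v $ (B + 2 ^ i) = 0)"
    using add_lessD1 by (auto simp: shear_mult_vec[OF assms] simp del: index_mult_mat_vec)
  finally show ?thesis .
qed

section \<open>Invariant polynomials and linear forms\<close>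

lemma bit_vec_add_add:
  "v \<in> carrier_vec N \<Longrightarrow> w \<in> carrier_vec N \<Longrightarrow> v + w + w = v" for v w :: "bit vec"
  by (intro eq_vecI) (auto simp: add.assoc bit_add_self)

text \<open>A monomial \<open>A \<noteq> 0\<close> with \<open>A < N \<le> 2 ^ n\<close> contains a
  variable \<open>i < n\<close>, and invariance under that translation kills its coefficient. Only
  the constant term survives.\<close>

lemma shear_fixed_vec:
  assumes v: "v \<in> carrier_vec N" and "N \<le> 2 ^ n" and fix_v: "\<And>i. i < n \<Longrightarrow> shear N i *\<^sub>v v = v"
  shows "v = 0\<^sub>v N \<or> v = unit_vec N 0"
proof -
  have "v $ A = 0" if "A < N" "A \<noteq> 0" for A
  proof -
    obtain i where i: "bit A i" using \<open>A \<noteq> 0\<close> by (metis bit_eq_iff bit_0_eq bot_apply bot_bool_def)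
    then obtain B where B: "\<not> bit B i" "A = B + 2 ^ i" by (rule bit_nat_decompose)
    then have "(2::nat) ^ i < 2 ^ n" using that(1) \<open>N \<le> 2 ^ n\<close> by linarith
    then have "i < n" by simp
    then show ?thesis using fix_v B that(1) by (simp add: shear_fixed_iff[OF v])
  qed
  then show ?thesis using v by (cases "v $ 0") (auto simp: vec_eq_iff)
qed

text \<open>The linear form with the variables in \<open>S\<close>: index \<open>2 ^ i\<close> is
  the i-th variable. Index 0 is the empty monomial, so \<open>unit_vec N 0\<close> is the constant
  polynomial 1.\<close>

definition linear_vec :: "nat \<Rightarrow> nat set \<Rightarrow> bit vec" where
  "linear_vec N S = vec N (\<lambda>A. of_bool (\<exists>i\<in>S. A = 2 ^ i))"

lemma linear_vec_carrier [simp]: "linear_vec N S \<in> carrier_vec N"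
  by (simp add: linear_vec_def)

lemma linear_vec_dim [simp]: "dim_vec (linear_vec N S) = N"
  by (simp add: linear_vec_def)

lemma power2_eq_add_power2:
  assumes "\<not> bit B i" "B + 2 ^ i = (2::nat) ^ k"
  shows "B = 0 \<and> i = k"
proof -
  have "bit ((2::nat) ^ k) i" using assms bit_add_power2[of B i i] by simp
  then have "i = k" by (simp add: bit_2_iff bit_exp_iff)
  then show ?thesis using assms by simp
qed

lemma shear_unit_vec: "shear N i *\<^sub>v unit_vec N 0 = unit_vec N 0"
  by (subst shear_fixed_iff) auto

lemma shear_linear_vec:
  assumes "2 ^ i < N"
  shows "shear N i *\<^sub>v linear_vec N S = (if i \<in> S then linear_vec N S + unit_vec N 0 else linear_vec N S)"
proof -
  have "(if \<not> bit B i \<and> B + 2 ^ i < N then linear_vec N S $ (B + 2 ^ i) else 0) = of_bool (B = 0 \<and> i \<in> S)"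
    if "B < N" for B
  proof (cases "B = 0")
    case True
    then show ?thesis using assms by (simp add: linear_vec_def)
  next
    case False
    then have "B + 2 ^ i \<noteq> 2 ^ k" if "\<not> bit B i" for k
      using power2_eq_add_power2[OF that] by blast
    then show ?thesis using False by (simp add: linear_vec_def)
  qed
  then have "(shear N i *\<^sub>v linear_vec N S) $ B = linear_vec N S $ B + of_bool (B = 0 \<and> i \<in> S)"
    if "B < N" for B
    using that by (simp add: shear_mult_vec del: index_mult_mat_vec)
  then show ?thesis
    by (intro eq_vecI) (auto simp del: index_mult_mat_vec)
qed

definition linear_pair :: "nat \<Rightarrow> nat set \<Rightarrow> bit vec set" where
  "linear_pair N S = {linear_vec N S, linear_vec N S + unit_vec N 0}"

lemma add_unit_vec_neq: "0 < N \<Longrightarrow> v \<in> carrier_vec N \<Longrightarrow> v + unit_vec N 0 \<noteq> v" for v :: "bit vec"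
  by (auto simp: vec_eq_iff dest: spec[of _ 0])

lemma shear_linear_pair:
  assumes "2 ^ i < N"
  shows "(*\<^sub>v) (shear N i) ` linear_pair N S = linear_pair N S"
    and "(\<exists>v\<in>linear_pair N S. shear N i *\<^sub>v v \<noteq> v) \<longleftrightarrow> i \<in> S"
proof -
  have "0 < N" using assms by auto
  have add: "shear N i *\<^sub>v (linear_vec N S + unit_vec N 0) = shear N i *\<^sub>v linear_vec N S + unit_vec N 0"
    using mult_add_distrib_mat_vec[of "shear N i" N N] by (simp add: shear_unit_vec)
  have cancel: "linear_vec N S + unit_vec N 0 + unit_vec N 0 = linear_vec N S"
    by (rule bit_vec_add_add[where N = N]) auto
  show "(*\<^sub>v) (shear N i) ` linear_pair N S = linear_pair N S"
    using cancel by (auto simp: linear_pair_def add shear_linear_vec[OF assms])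
  show "(\<exists>v\<in>linear_pair N S. shear N i *\<^sub>v v \<noteq> v) \<longleftrightarrow> i \<in> S"
    using add_unit_vec_neq[OF \<open>0 < N\<close>, of "linear_vec N S"] cancel
    by (auto simp: linear_pair_def add shear_linear_vec[OF assms])
qed

lemma linear_pair_two_subset: "0 < N \<Longrightarrow> linear_pair N S \<in> two_subsets (carrier_vec N)"
  using add_unit_vec_neq[of N "linear_vec N S"] by (auto simp: two_subsets_def linear_pair_def)

text \<open>If {v, w} is fixed, then v + w is invariant and nonzero, hence 1. Every translation thus
  changes v by a constant, so v is affine: a linear form up to its constant term, which only decides
  which of the two elements v is. Conversely, \<open>S\<close> is the set of translations that swap
  the pair.\<close>

lemma bij_betw_linear_pair:
  assumes "0 < N" "N \<le> 2 ^ n" and small: "\<And>i. i < n \<Longrightarrow> 2 ^ i < N"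
  shows "bij_betw (linear_pair N) (Pow {..<n})
    {A \<in> two_subsets (carrier_vec N). \<forall>i<n. (*\<^sub>v) (shear N i) ` A = A}"
  unfolding bij_betw_def
proof
  let ?t = "unit_vec N 0 :: bit vec"
  let ?moved = "\<lambda>P. {i \<in> {..<n}. \<exists>v\<in>P. shear N i *\<^sub>v v \<noteq> v}"
  have "?moved (linear_pair N S) = S" if "S \<in> Pow {..<n}" for S
  proof (rule Set.set_eqI)
    fix i
    show "i \<in> ?moved (linear_pair N S) \<longleftrightarrow> i \<in> S"
      using that shear_linear_pair(2)[OF small, of i S] by auto
  qed
  then show "inj_on (linear_pair N) (Pow {..<n})"
    by (rule inj_on_inverseI)
  show "linear_pair N ` Pow {..<n} =
    {A \<in> two_subsets (carrier_vec N). \<forall>i<n. (*\<^sub>v) (shear N i) ` A = A}" (is "_ = ?F")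
  proof
    show "linear_pair N ` Pow {..<n} \<subseteq> ?F"
      using linear_pair_two_subset[OF \<open>0 < N\<close>] shear_linear_pair(1)[OF small] by blast
    show "?F \<subseteq> linear_pair N ` Pow {..<n}"
    proof
      fix A assume A: "A \<in> ?F"
      then obtain v w where vw: "A = {v, w}" "v \<noteq> w" "v \<in> carrier_vec N" "w \<in> carrier_vec N"
        by (auto simp: two_subsets_def card_2_iff)
      have image: "(shear N i *\<^sub>v v = v \<and> shear N i *\<^sub>v w = w) \<or> (shear N i *\<^sub>v v = w \<and> shear N i *\<^sub>v w = v)"
        if "i < n" for i
        using A vw(1,2) that by (auto simp: doubleton_eq_iff)
      have "shear N i *\<^sub>v (v + w) = v + w" if "i < n" for i
        using image[OF that] vw(3,4) mult_add_distrib_mat_vec[of "shear N i" N N v w]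
        by (auto simp: comm_add_vec)
      then have "v + w = 0\<^sub>v N \<or> v + w = ?t"
        using shear_fixed_vec[OF _ \<open>N \<le> 2 ^ n\<close>, of "v + w"] vw by auto
      moreover have w_eq: "w = v + w + v"
        using bit_vec_add_add[of w N v] vw(3,4) comm_add_vec[of v N w] by simp
      moreover have "v + w \<noteq> 0\<^sub>v N"
        using w_eq vw(2,3) by auto
      ultimately have w: "w = v + ?t"
        using vw(3) comm_add_vec[of ?t N v] by (metis unit_vec_carrier)
      \<comment> \<open>All derivatives of \<open>v\<close> are constant, so the monomials with at
        least two variables have coefficient 0.\<close>
      have v_zero: "v $ (B + 2 ^ i) = 0" if "i < n" "\<not> bit B i" "B + 2 ^ i < N" "B \<noteq> 0" for i B
      proof -
        have "(shear N i *\<^sub>v v) $ B = v $ B \<or> (shear N i *\<^sub>v v) $ B = (v + ?t) $ B"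
          using image[OF that(1)] w by metis
        moreover have "(v + ?t) $ B = v $ B" using that by simp
        ultimately have "v $ B + v $ (B + 2 ^ i) = v $ B"
          using shear_mult_vec[OF vw(3), of B i] that by (simp del: index_mult_mat_vec)
        then show ?thesis by simp
      qed
      define S where "S = {i. i < n \<and> v $ (2 ^ i) = 1}"
      have v_S: "v $ C = linear_vec N S $ C" if C: "C < N" "C \<noteq> 0" for C
      proof -
        obtain i where i: "bit C i" using \<open>C \<noteq> 0\<close> by (metis bit_eq_iff bit_0_eq bot_apply bot_bool_def)
        then obtain B where B: "\<not> bit B i" "C = B + 2 ^ i" by (rule bit_nat_decompose)
        then have "(2::nat) ^ i < 2 ^ n" using C(1) \<open>N \<le> 2 ^ n\<close> by linarith
        then have "i < n" by simp
        show ?thesis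
        proof (cases "B = 0")
          case True
          then show ?thesis using B C \<open>i < n\<close> by (cases "v $ C") (auto simp: S_def linear_vec_def)
        next
          case False
          then have "C \<noteq> 2 ^ k" for k using B power2_eq_add_power2[of B i k] by auto
          then show ?thesis using v_zero[OF \<open>i < n\<close>] B C False by (auto simp: linear_vec_def)
        qed
      qed
      have "linear_vec N S $ 0 = 0" using \<open>0 < N\<close> by (simp add: linear_vec_def)
      then have "v = linear_vec N S \<or> v = linear_vec N S + ?t"
      proof (cases "v $ 0")
        case zero
        then have "v $ C = linear_vec N S $ C" if "C < N" for C
          using v_S[OF that] \<open>linear_vec N S $ 0 = 0\<close> by (cases "C = 0") simp_all
        then show ?thesis using vw(3) by (intro disjI1 eq_vecI) auto
      next
        case one
        then have "v $ C = (linear_vec N S + ?t) $ C" if "C < N" for C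
          using v_S[OF that] \<open>linear_vec N S $ 0 = 0\<close> that by (cases "C = 0") simp_all
        then show ?thesis using vw(3) by (intro disjI2 eq_vecI) auto
      qed
      then have "A = linear_pair N S"
        using vw w bit_vec_add_add[of "linear_vec N S" N ?t] by (auto simp: linear_pair_def)
      moreover have "S \<in> Pow {..<n}" by (auto simp: S_def)
      ultimately show "A \<in> linear_pair N ` Pow {..<n}" by blast
    qed
  qed
qed

section \<open>The natural action of the general linear group and the conclusion\<close>

lemma finite_carrier_vec_bit: "finite (carrier_vec N :: bit vec set)"
proof -
  have "x \<in> {0, 1}" for x :: bit by (cases x) simp_all
  then have "finite (UNIV :: bit set)" by (intro finite_subset[of UNIV "{0, 1}"]) auto
  then have "finite (vec_of_list ` {xs :: bit list. set xs \<subseteq> UNIV \<and> length xs = N})"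
    by (intro finite_imageI finite_lists_length_eq)
  moreover have "(carrier_vec N :: bit vec set) \<subseteq> vec_of_list ` {xs. set xs \<subseteq> UNIV \<and> length xs = N}"
    by (metis (mono_tags, lifting) carrier_vecD image_eqI length_list_of_vec mem_Collect_eq
        subsetI top_greatest vec_list)
  ultimately show ?thesis by (rule finite_subset[rotated])
qed

lemma carrier_GL:
  "carrier (GL TYPE('a::field) N) = {A \<in> carrier_mat N N. \<exists>B\<in>carrier_mat N N. B * A = 1\<^sub>m N \<and> A * B = 1\<^sub>m N}"
  by (simp add: GL_def units_of_carrier Units_def ring_mat_simps)

lemma mult_GL: "monoid.mult (GL TYPE('a::field) N) = (*)"
  and one_GL: "monoid.one (GL TYPE('a) N) = 1\<^sub>m N"
  by (simp_all add: GL_def units_of_mult units_of_one ring_mat_simps)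

lemma finite_action_GL: "finite_action (GL TYPE(bit) N) (carrier_vec N) (*\<^sub>v)"
proof -
  interpret group "GL TYPE(bit) N" by (rule group_GL)
  show ?thesis
    by unfold_locales (auto simp: finite_carrier_vec_bit carrier_GL mult_GL one_GL)
qed

theorem theorem2:
  fixes N d :: nat
  assumes "N \<ge> 2"
    and "\<lceil>log 2 (real N)\<rceil> \<le> int (card {i. bit d i})"
  shows "\<exists>x \<in> cohomology (GL TYPE(bit) N) d. \<not> nilpotent (cohomology_ring (GL TYPE(bit) N)) x"
proof -
  let ?G = "GL TYPE(bit) N"
  define n where "n = nat \<lceil>log 2 (real N)\<rceil>"
  have log: "1 \<le> log 2 (real N)" using \<open>N \<ge> 2\<close> by simp
  then have n_eq: "int n = \<lceil>log 2 (real N)\<rceil>" by (simp add: n_def)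
  then have "0 < n" using log by linarith
  have card: "n \<le> card {i. bit d i}" using assms(2) n_eq by linarith
  have "log 2 (real N) \<le> real n" using n_eq by linarith
  then have "real N \<le> 2 powr real n" using \<open>N \<ge> 2\<close> by (simp add: log_le_iff)
  then have "real N \<le> real (2 ^ n)" by (simp add: powr_realpow)
  then have N_le: "N \<le> 2 ^ n" by (simp only: of_nat_le_iff)
  have small: "2 ^ i < N" if "i < n" for i
  proof -
    have "real i < log 2 (real N)" using that n_eq by linarith
    then have "2 powr real i < real N" using \<open>N \<ge> 2\<close> by (simp add: less_log_iff)
    then have "real (2 ^ i) < real N" by (simp add: powr_realpow)
    then show ?thesis by (simp only: of_nat_less_iff)
  qed
  obtain y where y: "(\<Sum>S\<in>Pow {..<n}. (\<Sum>i\<in>S. y i) ^ d) \<noteq> (0 :: bit poly)"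
    using power_sum_linear_forms_nonzero[OF \<open>0 < n\<close> card] by blast
  \<comment> \<open>The extra index \<open>n\<close> carries the identity, with the coefficient that
    makes the augmentation 0: the chain element u is the sum of all \<open>y i\<close> times
    (\<open>shear N i\<close> + 1). The identity moves nothing, so this index neither restricts
    \<open>F\<close> nor adds to the power sums.\<close>
  define h where "h a = (if a < n then shear N a else 1\<^sub>m N)" for a
  define r where "r a = (if a < n then y a else \<Sum>i<n. y i)" for a
  have h_carrier: "h a \<in> carrier_mat N N" for a by (simp add: h_def)
  have h_square: "h a * h a = 1\<^sub>m N" for a by (simp add: h_def shear_square)
  interpret finite_action ?G "carrier_vec N" "(*\<^sub>v)" by (rule finite_action_GL)
  interpret action_involutions ?G "carrier_vec N" "(*\<^sub>v)" "{..n}" h r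
  proof
    fix a b
    show "h a \<in> carrier ?G" using h_carrier h_square by (auto simp: carrier_GL)
    show "h a \<otimes>\<^bsub>?G\<^esub> h b = h b \<otimes>\<^bsub>?G\<^esub> h a"
      by (simp add: mult_GL h_def shear_commute left_mult_one_mat[of _ N N] right_mult_one_mat[of _ N N])
    show "h a \<otimes>\<^bsub>?G\<^esub> h a = \<one>\<^bsub>?G\<^esub>" by (simp add: mult_GL one_GL h_square)
    show "sum r {..n} = 0"
      by (simp add: r_def bit_poly_add_self flip: lessThan_Suc_atMost)
  qed simp
  define F where "F = {A \<in> two_subsets (carrier_vec N). \<forall>a\<in>{..n}. (*\<^sub>v) (h a) ` A = A}"
  obtain f where f: "f \<in> cocycles ?G" "f \<in> homogeneous_cochains ?G d"
    and eval_f: "eval d f = (\<Sum>A\<in>F. (\<Sum>a\<in>{..n}. r a * [:of_bool (\<exists>v\<in>A. h a *\<^sub>v v \<noteq> v):]) ^ d)"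
    using exists_cocycle_two_subsets[of d] unfolding F_def by blast
  have "F = {A \<in> two_subsets (carrier_vec N). \<forall>i<n. (*\<^sub>v) (shear N i) ` A = A}"
    unfolding F_def
  proof (intro Collect_cong conj_cong refl)
    fix A :: "bit vec set" assume "A \<in> two_subsets (carrier_vec N)"
    then have "(*\<^sub>v) (1\<^sub>m N) ` A = A" by (force simp: two_subsets_def)
    then have "(*\<^sub>v) (h a) ` A = A \<longleftrightarrow> (a < n \<longrightarrow> (*\<^sub>v) (shear N a) ` A = A)" for a
      by (simp add: h_def)
    then show "(\<forall>a\<in>{..n}. (*\<^sub>v) (h a) ` A = A) \<longleftrightarrow> (\<forall>i<n. (*\<^sub>v) (shear N i) ` A = A)"
      by (meson atMost_iff less_imp_le)
  qed
  then have "bij_betw (linear_pair N) (Pow {..<n}) F"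
    using bij_betw_linear_pair[OF _ N_le small] \<open>N \<ge> 2\<close> by simp
  then have "eval d f = (\<Sum>S\<in>Pow {..<n}.
      (\<Sum>a\<in>{..n}. r a * [:of_bool (\<exists>v\<in>linear_pair N S. h a *\<^sub>v v \<noteq> v):]) ^ d)"
    unfolding eval_f by (rule sum.reindex_bij_betw[symmetric])
  also have "\<dots> = (\<Sum>S\<in>Pow {..<n}. (\<Sum>i\<in>S. y i) ^ d)"
  proof (rule sum.cong[OF refl], rule arg_cong[where f = "\<lambda>p. p ^ d"])
    fix S assume S: "S \<in> Pow {..<n}"
    have "(\<exists>v\<in>linear_pair N S. h a *\<^sub>v v \<noteq> v) \<longleftrightarrow> a \<in> S" if "a \<le> n" for a
    proof (cases "a < n")
      case True
      then show ?thesis using shear_linear_pair(2)[OF small] by (simp add: h_def)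
    next
      case False
      then show ?thesis using S by (auto simp: h_def linear_pair_def)
    qed
    then have "(\<Sum>a\<in>{..n}. r a * [:of_bool (\<exists>v\<in>linear_pair N S. h a *\<^sub>v v \<noteq> v):]) =
        (\<Sum>a\<in>{..n}. if a \<in> S then r a else 0)"
      by (intro sum.cong) auto
    also have "\<dots> = (\<Sum>a\<in>{..n} \<inter> S. r a)" by (simp add: sum.inter_restrict)
    also have "\<dots> = (\<Sum>i\<in>S. y i)"
      using S by (intro sum.cong) (auto simp: r_def)
    finally show "(\<Sum>a\<in>{..n}. r a * [:of_bool (\<exists>v\<in>linear_pair N S. h a *\<^sub>v v \<noteq> v):]) = (\<Sum>i\<in>S. y i)" .
  qed
  finally have "eval d f \<noteq> 0" using y by simp
  from not_nilpotent_cohomology[OF f this] show ?thesis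
    using f by (auto simp: cohomology_def)
qed

end
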